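(* Consider the iterates $(x^k)_{k\ge 0}$ and $(h_m^k)_{k\ge 0}$, $m\in[M]$, generated by the algorithm MURANA (defined in the context) with parameters $\gamma,\lambda,\rho$. Suppose that $0<\lambda\le \frac{1}{1+\omega_{\mathcal U}}$ and $0<\rho\le\frac{1}{1+\omega_{\mathcal R}}$, and set $\omega_{\mathcal U}'=\frac1\lambda-1\ge\omega_{\mathcal U}$ and $\omega_{\mathcal R}'=\frac1\rho-1\ge\omega_{\mathcal R}$. Choose a real $b>1$, and set $a=\max\big(1-(1+b)\zeta,0\big)$. Suppose that $$0<\gamma<\frac{2}{L}\,\frac{1}{a+(1+b)^2\omega_{\mathrm{av}}}.$$ Set $\eta = 1-\gamma\left(\frac{2}{L}\frac{1}{a+(1+b)^2\omega_{\mathrm{av}}}\right)^{-1}\in(0,1)$. For every $k\ge0$ define $$\Psi^k=\|x^k-x^\star\|^2+(b^2+b)\gamma^2\omega_{\mathrm{av}}\frac{1+\omega_{\mathcal U}'}{1+\omega_{\mathcal R}'}\frac1M\sum_{m=1}^M\|h_m^k-h_m^\star\|^2 .$$ Then, for every $k\ge0$, $\mathbb E[\Psi^k]\le c^k\Psi^0$, where $$c=1-\min\left\{\frac{2\gamma\eta\mu}{1+\omega_{\mathcal R}'},\ \frac{1-b^{-2}}{1+\omega_{\mathcal U}'}\right\}<1 .$$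
   Context: Problem. Let $d\ge1$, $M\ge1$, $[M]=\{1,\dots,M\}$. Let $F_1,\dots,F_M:\mathbb R^d\to\mathbb R$ be convex, differentiable and $L$-smooth for some $L>0$ (i.e. $\nabla F_m$ is $L$-Lipschitz), let $F=\frac1M\sum_{m=1}^M F_m$ be $\mu$-strongly convex for some $\mu>0$ (i.e. $F-\frac\mu2\|\cdot\|^2$ is convex), and let $R:\mathbb R^d\to\mathbb R\cup\{+\infty\}$ be proper, closed, convex. Let $x^\star$ be the unique minimizer of $R+F$ and $h_m^\star=\nabla F_m(x^\star)$. For $\gamma>0$, $\mathrm{prox}_{\gamma R}(w)=\arg\min_{x}\big(\gamma R(x)+\frac12\|x-w\|^2\big)$. Norms are Euclidean. Stochastic operators. For every $k\ge0$ and $m\in[M]$, $\mathcal C_m^k,\mathcal U_m^k,\mathcal R^k$ are random maps $\mathbb R^d\to\mathbb R^d$ such that for all $v\in\mathbb R^d$: $\mathbb E[\mathcal C_m^k(v)]=v$, $\mathbb E\|\mathcal C_m^k(v)-v\|^2\le\omega_{\mathcal C}\|v\|^2$; $\mathbb E[\mathcal U_m^k(v)]=v$, $\mathbb E\|\mathcal U_m^k(v)-v\|^2\le\omega_{\mathcal U}\|v\|^2$; $\mathbb E[\mathcal R^k(v)]=v$, $\mathbb E\|\mathcal R^k(v)-v\|^2\le\omega_{\mathcal R}\|v\|^2$, for constants $\omega_{\mathcal C},\omega_{\mathcal U},\omega_{\mathcal R}\ge0$. Moreover there are constants $\omega_{\mathrm{av}}\ge0$ and $\zeta\in[0,\omega_{\mathrm{av}}]$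 such that for every $k$ and all $v_1,\dots,v_M\in\mathbb R^d$, $$\mathbb E\Big\|\frac1M\sum_{m=1}^M(\mathcal C_m^k(v_m)-v_m)\Big\|^2\le\frac{\omega_{\mathrm{av}}}{M}\sum_{m=1}^M\|v_m\|^2-\zeta\Big\|\frac1M\sum_{m=1}^M v_m\Big\|^2 .$$ The collections $\big((\mathcal C_m^k)_m,(\mathcal U_m^k)_m\big)$ for different $k$ are independent; for a fixed $k$ the operators $\mathcal C_m^k,\mathcal U_{m'}^k$ ($m,m'\in[M]$) may be arbitrarily dependent. The $\mathcal R^k$, $k\ge0$, are mutually independent and independent of all $\mathcal C_m^{k'},\mathcal U_m^{k'}$. (The random maps are assumed measurable, so that the unbiasedness of $\mathcal C_m^k,\mathcal U_m^k,\mathcal R^k$, their variance bounds with constants $\omega_{\mathcal C},\omega_{\mathcal U},\omega_{\mathcal R}$, and the bound with constants $\omega_{\mathrm{av}},\zeta$ on the second moment of $\frac1M\sum_{m=1}^M(\mathcal C_m^k(v_m)-v_m)$ also hold conditionally when the operators are applied to random vectors independent of them.) Algorithm MURANA. Input: $\gamma,\lambda,\rho>0$, deterministic $x^0\in\mathbb R^d$ and $h_1^0,\dots,h_M^0\in\mathbb R^d$; $h^0=\frac1M\sum_m h_m^0$. For $k=0,1,\dots$: for every $m\in[M]$, $d_m^{k+1}=\mathcal C_m^k(\nabla F_m(x^k)-h_m^k)$, $u_m^{k+1}=\mathcal U_m^k(\nabla F_m(x^k)-h_m^k)$, $h_m^{k+1}=h_m^k+\lambda u_m^{k+1}$; then $d^{k+1}=\frac1M\sum_m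 d_m^{k+1}$, $\tilde x^{k+1}=\mathrm{prox}_{\gamma R}\big(x^k-\gamma(h^k+d^{k+1})\big)$, $x^{k+1}=x^k+\rho\,\mathcal R^k(\tilde x^{k+1}-x^k)$, $h^{k+1}=h^k+\frac\lambda M\sum_m u_m^{k+1}$. *)

theory Defs
  imports "HOL-Probability.Probability"
begin

definition avg :: "nat \<Rightarrow> (nat \<Rightarrow> 'a) \<Rightarrow> 'a::real_vector" where
  "avg M f = (1 / real M) *\<^sub>R (\<Sum>m=1..M. f m)"

text \<open>
  The library notion \<^const>\<open>convex_on\<close> only covers real-valued functions, so closedness and convexity
  of an extended-real-valued function are expressed by its epigraph, a subset of the
  ambient space times the reals.
\<close>

definition epi :: "('a \<Rightarrow> ereal) \<Rightarrow> ('a \<times> real) set" where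
  "epi R = {(x, t). R x \<le> ereal t}"

definition proper_closed_convex :: "('a::euclidean_space \<Rightarrow> ereal) \<Rightarrow> bool" where
  "proper_closed_convex R \<longleftrightarrow>
     (\<forall>x. R x \<noteq> -\<infinity>) \<and> (\<exists>x. R x \<noteq> \<infinity>) \<and> closed (epi R) \<and> convex (epi R)"

definition prox :: "real \<Rightarrow> ('a::euclidean_space \<Rightarrow> ereal) \<Rightarrow> 'a \<Rightarrow> 'a" where
  "prox \<gamma> R w = arg_min (\<lambda>x. ereal \<gamma> * R x + ereal (1 / 2 * (norm (x - w))\<^sup>2)) (\<lambda>_. True)"

text \<open>
  A random map is a function \<open>Q s v\<close> of the outcome \<open>s\<close> and of the argument \<open>v\<close>.  Integrability
  is required explicitly because the Bochner integral of a non-integrable function is \<open>0\<close>.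
\<close>

definition unbiased_compressor ::
    "'s measure \<Rightarrow> real \<Rightarrow> ('s \<Rightarrow> 'a \<Rightarrow> 'a::euclidean_space) \<Rightarrow> bool" where
  "unbiased_compressor P \<omega> Q \<longleftrightarrow> (\<forall>v.
     integrable P (\<lambda>s. Q s v) \<and> (\<integral>s. Q s v \<partial>P) = v \<and>
     integrable P (\<lambda>s. (norm (Q s v - v))\<^sup>2) \<and>
     (\<integral>s. (norm (Q s v - v))\<^sup>2 \<partial>P) \<le> \<omega> * (norm v)\<^sup>2)"

text \<open>
  Measurability of a random map is joint in outcome and argument, and relative to the same
  sub-\<open>\<sigma>\<close>-algebra that carries its independence from the other maps.  Then (by Fubini) the
  assumptions on \<open>Q s v\<close> for fixed \<open>v\<close> transfer to random arguments independent of that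
  \<open>\<sigma>\<close>-algebra.  Joint measurability relative to the whole space together with independence of the
  evaluations \<open>Q s v\<close> at fixed \<open>v\<close> would not suffice: take a vector \<open>X\<close> with a continuous
  distribution, a fixed \<open>e \<noteq> 0\<close>, and let \<open>Q s v = v + e\<close> if \<open>v = X s\<close>, and \<open>Q s v = v\<close> otherwise.
\<close>

definition random_map ::
    "'s measure \<Rightarrow> ('s \<Rightarrow> 'a \<Rightarrow> 'a::euclidean_space) \<Rightarrow> bool" where
  "random_map G Q \<longleftrightarrow> (\<lambda>(s, v). Q s v) \<in> borel_measurable (G \<Otimes>\<^sub>M borel)"

text \<open>
  \<open>G k\<close> carries all the maps \<open>C k m\<close> and \<open>U k m\<close> with this \<open>k\<close>, hence these may depend on
  each other arbitrarily, and \<open>H k\<close> carries \<open>Q k\<close>.  The members of the combined family of all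
  \<open>G k\<close> and all \<open>H k\<close> are mutually independent.
\<close>

definition independent_rounds ::
    "'s measure \<Rightarrow> nat \<Rightarrow> (nat \<Rightarrow> 's measure) \<Rightarrow> (nat \<Rightarrow> 's measure) \<Rightarrow>
     (nat \<Rightarrow> nat \<Rightarrow> 's \<Rightarrow> 'a \<Rightarrow> 'a::euclidean_space) \<Rightarrow> (nat \<Rightarrow> nat \<Rightarrow> 's \<Rightarrow> 'a \<Rightarrow> 'a) \<Rightarrow>
     (nat \<Rightarrow> 's \<Rightarrow> 'a \<Rightarrow> 'a) \<Rightarrow> bool" where
  "independent_rounds P M G H C U Q \<longleftrightarrow>
     (\<forall>k. subalgebra P (G k) \<and> subalgebra P (H k)) \<and>
     (\<forall>k. \<forall>m\<in>{1..M}. random_map (G k) (C k m) \<and> random_map (G k) (U k m)) \<and>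
     (\<forall>k. random_map (H k) (Q k)) \<and>
     prob_space.indep_sets P
       (case_sum (\<lambda>k. sets (G k)) (\<lambda>k. sets (H k))) (UNIV :: (nat + nat) set)"

text \<open>
  A state is a triple of the iterate, the family of local control vectors, and the separately
  maintained vector that tracks their average.  The operators are realised ones, i.e. they are taken
  at one fixed outcome.
\<close>

definition murana_step ::
    "nat \<Rightarrow> (nat \<Rightarrow> 'a \<Rightarrow> 'a) \<Rightarrow> ('a \<Rightarrow> ereal) \<Rightarrow> real \<Rightarrow> real \<Rightarrow> real \<Rightarrow>
     (nat \<Rightarrow> 'a \<Rightarrow> 'a) \<Rightarrow> (nat \<Rightarrow> 'a \<Rightarrow> 'a) \<Rightarrow> ('a \<Rightarrow> 'a) \<Rightarrow>
     'a \<times> (nat \<Rightarrow> 'a) \<times> 'a \<Rightarrow> 'a::euclidean_space \<times> (nat \<Rightarrow> 'a) \<times> 'a" where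
  "murana_step M grad R \<gamma> lam \<rho> C U Q = (\<lambda>(x, h, hbar).
     let d = (\<lambda>m. C m (grad m x - h m));
         u = (\<lambda>m. U m (grad m x - h m));
         xt = prox \<gamma> R (x - \<gamma> *\<^sub>R (hbar + avg M d))
     in (x + \<rho> *\<^sub>R Q (xt - x), \<lambda>m. h m + lam *\<^sub>R u m, hbar + lam *\<^sub>R avg M u))"

primrec murana ::
    "nat \<Rightarrow> (nat \<Rightarrow> 'a \<Rightarrow> 'a) \<Rightarrow> ('a \<Rightarrow> ereal) \<Rightarrow> real \<Rightarrow> real \<Rightarrow> real \<Rightarrow> 'a \<Rightarrow> (nat \<Rightarrow> 'a) \<Rightarrow>
     (nat \<Rightarrow> nat \<Rightarrow> 'a \<Rightarrow> 'a) \<Rightarrow> (nat \<Rightarrow> nat \<Rightarrow> 'a \<Rightarrow> 'a) \<Rightarrow> (nat \<Rightarrow> 'a \<Rightarrow> 'a) \<Rightarrow> nat \<Rightarrow>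
     'a::euclidean_space \<times> (nat \<Rightarrow> 'a) \<times> 'a" where
  "murana M grad R \<gamma> lam \<rho> x0 h0 C U Q 0 = (x0, h0, avg M h0)"
| "murana M grad R \<gamma> lam \<rho> x0 h0 C U Q (Suc k) =
     murana_step M grad R \<gamma> lam \<rho> (C k) (U k) (Q k) (murana M grad R \<gamma> lam \<rho> x0 h0 C U Q k)"

end

theory Submission
  imports Defs
begin

text \<open>
  The minimiser \<open>xstar\<close> is a fixed point of the proximal gradient step, and \<open>prox\<close> is nonexpansive, so
  the error of the proximal step is at most that of the gradient step with the noisy gradient.
  Write \<open>p m\<close> for \<open>grad m x - grad m xstar\<close> and \<open>q m\<close> for \<open>h m - grad m xstar\<close>.  The variance of the
  noise splits into a multiple of \<open>|p|\<^sup>2\<close>, which cocoercivity absorbs into the descent term as the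
  step size is small, and a multiple of \<open>|q|\<^sup>2\<close>, which the contraction of the control vectors in the
  Lyapunov function absorbs.  The two sources of randomness in a round are integrated out one after
  the other, by Fubini's theorem for independent sub-\<open>\<sigma>\<close>-algebras.
\<close>

section \<open>Convex analysis and proximal operators\<close>

text \<open>The weight \<open>K\<close> of the control vectors is fixed by two demands. Young's
  inequality with parameter \<open>b\<close> leaves noise coefficients (1 + b) \<omega> for |p|^2
  and (1 + 1/b) \<omega> for |q|^2, while the control update trades a share \<open>lam\<close> of
  |q|^2 for |p|^2. This choice of \<open>K\<close> makes the noise in q equal to a share 1/b^2 of
  the decrease \<open>K\<close> * \<open>lam\<close>, hence the rate (1 - 1/b^2) \<open>lam\<close>;
  and it turns the p part into (1 + b) + (b^2 + b) = (1 + b)^2, the factor in the step size limit.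
  The number \<open>\<eta>\<close> is the fraction of the descent term that cocoercivity leaves
  over; strong convexity converts it into the other rate. The obstacle in the probabilistic half is
  that operators act on random points. Integrands therefore carry two outcomes, one for the state
  and one for the fresh operators: with the state frozen, the assumptions on constant arguments
  apply. The order is forced, since \<open>Q k\<close> acts on a point computed from
  \<open>C k\<close>: it is averaged out while \<open>C k\<close> still counts as known. The
  induction runs on nonnegative extended integrals, so integrability need not be carried
  along.\<close>

lemma GDERIV_along_line:
  fixes f :: "'a::real_inner \<Rightarrow> real"
  assumes "GDERIV f (x + t *\<^sub>R v) :> g"
  shows "((\<lambda>t. f (x + t *\<^sub>R v)) has_real_derivative inner g v) (at t)"
proof -
  have "((\<lambda>t. x + t *\<^sub>R v) has_derivative (\<lambda>s. s *\<^sub>R v)) (at t)"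
    by (auto intro!: derivative_eq_intros)
  moreover have "(f has_derivative (\<lambda>u. inner u g)) (at (x + t *\<^sub>R v))"
    using assms by (simp add: gderiv_def)
  ultimately have "((\<lambda>t. f (x + t *\<^sub>R v)) has_derivative (\<lambda>s. inner (s *\<^sub>R v) g)) (at t)"
    by (rule has_derivative_compose)
  then show ?thesis
    by (simp add: has_field_derivative_def inner_commute mult_commute_abs)
qed

lemma convex_on_along_line:
  fixes f :: "'a::real_vector \<Rightarrow> real"
  assumes "convex_on UNIV f"
  shows "convex_on UNIV (\<lambda>t. f (x + t *\<^sub>R v))"
proof (rule convex_onI)
  fix t a b :: real assume t: "0 < t" "t < 1"
  have "x + ((1 - t) *\<^sub>R a + t *\<^sub>R b) *\<^sub>R v = (1 - t) *\<^sub>R (x + a *\<^sub>R v) + t *\<^sub>R (x + b *\<^sub>R v)"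
    by (simp add: algebra_simps)
  then show "f (x + ((1 - t) *\<^sub>R a + t *\<^sub>R b) *\<^sub>R v)
      \<le> (1 - t) * f (x + a *\<^sub>R v) + t * f (x + b *\<^sub>R v)"
    using convex_onD[OF assms, of t "x + a *\<^sub>R v" "x + b *\<^sub>R v"] t by simp
qed simp

text \<open>On the line through x and y this is the tangent inequality for a convex function of one
  real variable.\<close>

lemma convex_on_above_gradient:
  fixes f :: "'a::real_inner \<Rightarrow> real"
  assumes "convex_on UNIV f" and "GDERIV f x :> g"
  shows "f x + inner g (y - x) \<le> f y"
proof -
  have "((\<lambda>t. f (x + t *\<^sub>R (y - x))) has_real_derivative inner g (y - x)) (at 0)"
    using assms(2) by (intro GDERIV_along_line) simp
  from convex_on_imp_above_tangent[OF convex_on_along_line[OF assms(1)] _ _ _ this, of 1]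
  show ?thesis by simp
qed

text \<open>Along the segment from x to y the gap between the two sides has a nonpositive
  derivative, by Cauchy-Schwarz and the Lipschitz bound. No integral of the gradient is
  involved.\<close>

lemma lipschitz_gradient_upper_bound:
  fixes f :: "'a::real_inner \<Rightarrow> real"
  assumes grad: "\<And>y. GDERIV f y :> g y" and lip: "L-lipschitz_on UNIV g"
  shows "f y \<le> f x + inner (g x) (y - x) + L / 2 * (norm (y - x))\<^sup>2"
proof -
  define v where "v = y - x"
  define \<phi> where "\<phi> t = f (x + t *\<^sub>R v) - t * inner (g x) v - L / 2 * t\<^sup>2 * (norm v)\<^sup>2" for t
  have "\<phi> 1 \<le> \<phi> 0"
  proof (rule DERIV_nonpos_imp_nonincreasing[where f = \<phi>])
    fix t :: real assume t: "0 \<le> t" "t \<le> 1"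
    have "(\<phi> has_real_derivative
        inner (g (x + t *\<^sub>R v)) v - inner (g x) v - L * t * (norm v)\<^sup>2) (at t)"
      unfolding \<phi>_def
      by (rule derivative_eq_intros GDERIV_along_line grad refl | simp)+
    moreover have "inner (g (x + t *\<^sub>R v) - g x) v \<le> L * t * (norm v)\<^sup>2"
    proof -
      have "inner (g (x + t *\<^sub>R v) - g x) v \<le> norm (g (x + t *\<^sub>R v) - g x) * norm v"
        by (rule norm_cauchy_schwarz)
      also have "\<dots> \<le> L * norm (t *\<^sub>R v) * norm v"
        using lipschitz_onD[OF lip, of "x + t *\<^sub>R v" x]
        by (intro mult_right_mono) (auto simp: dist_norm)
      finally show ?thesis using t by (simp add: power2_eq_square)
    qed
    ultimately show "\<exists>d. (\<phi> has_real_derivative d) (at t) \<and> d \<le> 0"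
      by (auto simp: inner_diff_left)
  qed simp
  then show ?thesis by (simp add: \<phi>_def v_def)
qed

text \<open>Baillon--Haddad: minimise over \<open>z\<close> the upper bound at \<open>y\<close> of the convex function
  \<open>f - inner (g x)\<close>, whose minimum is attained at \<open>x\<close>.\<close>

lemma gradient_cocoercive:
  fixes f :: "'a::real_inner \<Rightarrow> real"
  assumes "convex_on UNIV f" and grad: "\<And>y. GDERIV f y :> g y"
    and lip: "L-lipschitz_on UNIV g" and L: "L > 0"
  shows "(norm (g y - g x))\<^sup>2 \<le> L * inner (g y - g x) (y - x)"
proof -
  have *: "f x + inner (g x) (y - x) + (norm (g y - g x))\<^sup>2 / (2 * L) \<le> f y" for x y
  proof -
    define w where "w = g y - g x"
    define z where "z = y - (1 / L) *\<^sub>R w"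
    have "f x + inner (g x) (z - x) \<le> f z"
      by (rule convex_on_above_gradient[OF assms(1) grad])
    also have "\<dots> \<le> f y + inner (g y) (z - y) + L / 2 * (norm (z - y))\<^sup>2"
      by (rule lipschitz_gradient_upper_bound[OF grad lip])
    finally have "f x + inner (g x) (y - x) + inner w (y - z) - L / 2 * (norm (z - y))\<^sup>2 \<le> f y"
      by (simp add: w_def inner_diff_left inner_diff_right)
    moreover have "inner w (y - z) - L / 2 * (norm (z - y))\<^sup>2 = (norm w)\<^sup>2 / (2 * L)"
      using L by (simp add: z_def power2_norm_eq_inner power2_eq_square[of L] field_simps)
    ultimately show ?thesis by (simp add: w_def)
  qed
  \<comment> \<open>Exchanging x and y and adding cancels the values of f; the two halves 1 / (2 L)
    add up to 1 / L.\<close>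
  have "2 * ((norm (g y - g x))\<^sup>2 / (2 * L)) \<le> inner (g y - g x) (y - x)"
    using *[of x y] *[of y x] by (simp add: norm_minus_commute inner_diff_left inner_diff_right)
  then show ?thesis using L by (simp add: field_simps)
qed

text \<open>The gradient of the convex function \<open>f y - \<mu> / 2 * (norm y)\<^sup>2\<close> is
  monotone: its tangent inequalities at x and at y are added.\<close>

lemma strongly_convex_gradient_monotone:
  fixes f :: "'a::real_inner \<Rightarrow> real"
  assumes conv: "convex_on UNIV (\<lambda>y. f y - \<mu> / 2 * (norm y)\<^sup>2)"
    and grad: "\<And>y. GDERIV f y :> g y"
  shows "\<mu> * (norm (y - x))\<^sup>2 \<le> inner (g y - g x) (y - x)"
proof -
  have d: "GDERIV (\<lambda>y. f y - \<mu> / 2 * (norm y)\<^sup>2) y :> g y - \<mu> *\<^sub>R y" for y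
    using grad[of y] unfolding gderiv_def power2_norm_eq_inner
    by (auto intro!: derivative_eq_intros simp: algebra_simps inner_commute)
  show ?thesis
    using convex_on_above_gradient[OF conv d, of x y] convex_on_above_gradient[OF conv d, of y x]
    by (simp add: power2_norm_eq_inner algebra_simps inner_diff_left inner_diff_right inner_commute)
qed

lemma proper_closed_convex_finite_point:
  assumes "proper_closed_convex R"
  obtains x r where "R x = ereal r"
  using assms unfolding proper_closed_convex_def by (metis ereal_cases)

text \<open>A hyperplane separates the epigraph from a point one unit below it. The result limits
  the decrease of R to linear growth, which is what makes the proximal objective coercive.\<close>

lemma affine_minorant:
  assumes R: "proper_closed_convex R"
  shows "\<exists>\<beta> \<alpha>. \<forall>x t. (x, t) \<in> epi R \<longrightarrow> \<beta> - inner \<alpha> x \<le> t"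
proof -
  obtain x0 r0 where x0: "R x0 = ereal r0"
    using proper_closed_convex_finite_point[OF R] .
  have "convex (epi R)" "closed (epi R)" "(x0, r0 - 1) \<notin> epi R"
    using R x0 by (auto simp: proper_closed_convex_def epi_def)
  from separating_hyperplane_closed_point[OF this]
  obtain \<alpha> s \<beta> where sep: "inner (\<alpha>, s) (x0, r0 - 1) < \<beta>"
    "\<And>p. p \<in> epi R \<Longrightarrow> \<beta> < inner (\<alpha>, s) p"
    by (metis surj_pair)
  have "\<beta> < inner \<alpha> x0 + s * r0"
    using sep(2)[of "(x0, r0)"] x0 by (simp add: epi_def)
  \<comment> \<open>The hyperplane is not vertical: it separates two points that differ only in the
    last coordinate.\<close>
  then have s: "s > 0" using sep(1) by (simp add: algebra_simps)
  show ?thesis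
  proof (intro exI allI impI)
    fix x t assume "(x, t) \<in> epi R"
    then show "\<beta> / s - inner ((1 / s) *\<^sub>R \<alpha>) x \<le> t"
      using sep(2)[of "(x, t)"] s by (simp add: field_simps)
  qed
qed

text \<open>The minimisation is moved to the epigraph, where the objective \<open>g\<close> is
  continuous and lower semicontinuity of R appears as closedness. The sublevel set \<open>A\<close>
  is compact, because the quadratic term outgrows the affine minorant.\<close>

lemma proximal_objective_attains_min:
  fixes R :: "'a::euclidean_space \<Rightarrow> ereal"
  assumes R: "proper_closed_convex R" and k: "\<kappa> > 0"
  shows "\<exists>z. is_arg_min (\<lambda>x. R x + ereal (\<kappa> * (norm (x - w))\<^sup>2)) (\<lambda>_. True) z"
proof -
  obtain x0 r0 where x0: "R x0 = ereal r0"
    using proper_closed_convex_finite_point[OF R] .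
  obtain \<beta> \<alpha> where min: "\<And>x t. (x, t) \<in> epi R \<Longrightarrow> \<beta> - inner \<alpha> x \<le> t"
    using affine_minorant[OF R] by blast
  define g where "g p = snd p + \<kappa> * (norm (fst p - w))\<^sup>2" for p :: "'a \<times> real"
  define A where "A = {p \<in> epi R. g p \<le> g (x0, r0)}"
  have x0A: "(x0, r0) \<in> A" using x0 by (simp add: A_def epi_def)
  have cont: "continuous_on S g" for S
    unfolding g_def by (intro continuous_intros)
  have "closed A"
  proof -
    have "A = epi R \<inter> g -` {..g (x0, r0)}" by (auto simp: A_def)
    then show ?thesis
      using R cont[of UNIV] by (auto simp: proper_closed_convex_def continuous_on_closed_vimage
          intro!: closed_Int)
  qed
  moreover have "bounded A"
  proof -
    define c where "c = \<bar>g (x0, r0)\<bar> + \<bar>\<beta>\<bar> + norm \<alpha> * norm w"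
    \<comment> \<open>For u >= 1 with u > (c + |\<alpha>|) / \<kappa>, the quadratic \<kappa> u^2
      exceeds c + |\<alpha>| u, the largest value that membership in \<open>A\<close>
      permits.\<close>
    define B where "B = max 1 ((c + norm \<alpha>) / \<kappa>)"
    have bd: "norm (x - w) \<le> B \<and> \<bar>t\<bar> \<le> c + norm \<alpha> * B" if p: "(x, t) \<in> A" for x t
    proof -
      let ?u = "norm (x - w)"
      have "inner \<alpha> x = inner \<alpha> w + inner \<alpha> (x - w)" by (simp add: inner_diff_right)
      also have "\<dots> \<le> norm \<alpha> * norm w + norm \<alpha> * ?u"
        by (intro add_mono norm_cauchy_schwarz)
      finally have t: "- c - norm \<alpha> * ?u + \<bar>g (x0, r0)\<bar> \<le> t"
        using min[of x t] p by (auto simp: A_def c_def)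
      have gt: "t + \<kappa> * ?u\<^sup>2 \<le> g (x0, r0)" using p by (simp add: A_def g_def)
      have u: "\<kappa> * ?u\<^sup>2 \<le> c + norm \<alpha> * ?u" using t gt by linarith
      have "?u \<le> B"
      proof (rule ccontr)
        assume "\<not> ?u \<le> B"
        then have 1: "1 \<le> ?u" and 2: "(c + norm \<alpha>) / \<kappa> < ?u" by (auto simp: B_def)
        have "c + norm \<alpha> * ?u \<le> (c + norm \<alpha>) * ?u"
          using mult_left_mono[OF 1, of c] by (simp add: algebra_simps c_def)
        also have "\<dots> < (\<kappa> * ?u) * ?u"
          using 1 2 k by (intro mult_strict_right_mono) (auto simp: field_simps)
        finally show False using u by (simp add: power2_eq_square)
      qed
      moreover have "norm \<alpha> * ?u \<le> norm \<alpha> * B"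
        using \<open>?u \<le> B\<close> by (intro mult_left_mono) auto
      moreover have "t \<le> c + norm \<alpha> * B"
      proof -
        have "0 \<le> \<kappa> * ?u\<^sup>2" "0 \<le> norm \<alpha> * B" "0 \<le> norm \<alpha> * norm w"
          using k by (auto simp: B_def)
        then show ?thesis using gt unfolding c_def by linarith
      qed
      ultimately show ?thesis using t by linarith
    qed
    have "A \<subseteq> cball w B \<times> cball 0 (c + norm \<alpha> * B)"
      using bd by (auto simp: dist_norm norm_minus_commute)
    then show ?thesis
      by (rule bounded_subset[OF bounded_Times[OF bounded_cball bounded_cball]])
  qed
  ultimately have "compact A" by (simp add: compact_eq_bounded_closed)
  then obtain z r where zA: "(z, r) \<in> A" and z: "\<And>p. p \<in> A \<Longrightarrow> g (z, r) \<le> g p"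
    using continuous_attains_inf[OF _ _ cont, of A] x0A by (metis empty_iff surj_pair)
  have "R z + ereal (\<kappa> * (norm (z - w))\<^sup>2) \<le> R y + ereal (\<kappa> * (norm (y - w))\<^sup>2)" for y
  proof (cases "R y")
    case (real t)
    \<comment> \<open>Epigraph points outside \<open>A\<close> have values above
      \<open>g (x0, r0)\<close>, hence above the minimum over \<open>A\<close>.\<close>
    have "g (z, r) \<le> g (y, t)"
      using z[of "(y, t)"] zA real by (cases "(y, t) \<in> A") (auto simp: A_def epi_def)
    moreover have "R z \<le> ereal r" using zA by (simp add: A_def epi_def)
    then have "R z + ereal (\<kappa> * (norm (z - w))\<^sup>2) \<le> ereal (g (z, r))"
      unfolding g_def by (cases "R z") auto
    ultimately show ?thesis using real by (auto simp: g_def elim: order_trans)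
  next
    case MInf
    then show ?thesis using R by (simp add: proper_closed_convex_def)
  qed simp
  then show ?thesis by (auto simp: is_arg_min_def not_less)
qed

text \<open>In other words, -g is a subgradient of R at z; epigraph points avoid infinite values. On
  the way from z to y the value of R stays below its chord, so a negative slope of chord plus
  \<open>\<phi>\<close> at z would contradict minimality. It serves for the proximal objective and
  for the objective minimised by \<open>xstar\<close>.\<close>

lemma composite_minimizer_variational_inequality:
  fixes R :: "'a::euclidean_space \<Rightarrow> ereal"
  assumes R: "proper_closed_convex R"
    and z: "is_arg_min (\<lambda>y. R y + ereal (\<phi> y)) (\<lambda>_. True) z"
    and grad: "GDERIV \<phi> z :> g"
  shows "\<exists>r. (z, r) \<in> epi R \<and> (\<forall>y t. (y, t) \<in> epi R \<longrightarrow> r \<le> t + inner g (y - z))"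
proof -
  have le: "R z + ereal (\<phi> z) \<le> R y + ereal (\<phi> y)" for y
    using z by (auto simp: is_arg_min_def not_less)
  obtain x0 r0 where "R x0 = ereal r0" using proper_closed_convex_finite_point[OF R] .
  then have "R z \<noteq> \<infinity>" using le[of x0] by auto
  then obtain r where r: "R z = ereal r"
    using R by (cases "R z") (auto simp: proper_closed_convex_def)
  show ?thesis
  proof (intro exI[of _ r] conjI allI impI)
    show zr: "(z, r) \<in> epi R" using r by (simp add: epi_def)
    fix y t assume y: "(y, t) \<in> epi R"
    \<comment> \<open>The objective along the segment, with R replaced by its chord and the constant
      r removed.\<close>
    define \<psi> where "\<psi> \<tau> = \<tau> * (t - r) + \<phi> (z + \<tau> *\<^sub>R (y - z))" for \<tau>
    have d: "(\<psi> has_real_derivative (t - r) + inner g (y - z)) (at 0)"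
      unfolding \<psi>_def
      by (rule derivative_eq_intros GDERIV_along_line[where g = g] refl | simp add: grad)+
    have ge: "\<psi> 0 \<le> \<psi> \<tau>" if "0 < \<tau>" "\<tau> < 1" for \<tau>
    proof -
      have "(1 - \<tau>) *\<^sub>R (z, r) + \<tau> *\<^sub>R (y, t) \<in> epi R"
        using R zr y that unfolding proper_closed_convex_def by (intro convexD) auto
      then have "R (z + \<tau> *\<^sub>R (y - z)) \<le> ereal (r + \<tau> * (t - r))"
        by (simp add: epi_def algebra_simps)
      then have "ereal (r + \<phi> z) \<le> ereal (r + \<tau> * (t - r)) + ereal (\<phi> (z + \<tau> *\<^sub>R (y - z)))"
        using le[of "z + \<tau> *\<^sub>R (y - z)"] r
        by (cases "R (z + \<tau> *\<^sub>R (y - z))") auto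
      then show ?thesis by (simp add: \<psi>_def)
    qed
    show "r \<le> t + inner g (y - z)"
    proof (rule ccontr)
      assume "\<not> ?thesis"
      then obtain e where e: "e > 0" "\<And>h. 0 < h \<Longrightarrow> h < e \<Longrightarrow> \<psi> (0 + h) < \<psi> 0"
        using DERIV_neg_dec_right[OF d] by fastforce
      obtain h where h: "0 < h" "h < e" "h < 1"
        using dense[of 0 "min e 1"] e(1) by auto
      show False using ge[OF h(1,3)] e(2)[OF h(1,2)] by simp
    qed
  qed
qed

text \<open>Each inequality is tested at the other point. Their sum is monotonicity of the
  subdifferential, which gives |z1 - z2|^2 <= inner (w1 - w2) (z1 - z2).\<close>

lemma variational_inequality_nonexpansive:
  fixes E :: "('a::real_inner \<times> real) set"
  assumes g: "\<gamma> > 0" and 1: "(z1, r1) \<in> E" and 2: "(z2, r2) \<in> E"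
    and vi1: "\<And>y t. (y, t) \<in> E \<Longrightarrow> r1 \<le> t + inner ((1 / \<gamma>) *\<^sub>R (z1 - w1)) (y - z1)"
    and vi2: "\<And>y t. (y, t) \<in> E \<Longrightarrow> r2 \<le> t + inner ((1 / \<gamma>) *\<^sub>R (z2 - w2)) (y - z2)"
  shows "norm (z1 - z2) \<le> norm (w1 - w2)"
proof -
  have "0 \<le> (1 / \<gamma>) * (inner (z1 - w1) (z2 - z1) + inner (z2 - w2) (z1 - z2))"
    using vi1[OF 2] vi2[OF 1] by (simp add: distrib_left)
  then have "0 \<le> inner (z1 - w1) (z2 - z1) + inner (z2 - w2) (z1 - z2)"
    using g by (simp add: zero_le_mult_iff zero_le_divide_iff)
  then have "inner (z1 - z2) (z1 - z2) \<le> inner (w1 - w2) (z1 - z2)"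
    by (simp add: inner_diff_left inner_diff_right inner_commute)
  also have "\<dots> \<le> norm (w1 - w2) * norm (z1 - z2)" by (rule norm_cauchy_schwarz)
  finally have "norm (z1 - z2) * norm (z1 - z2) \<le> norm (w1 - w2) * norm (z1 - z2)"
    by (simp add: norm_eq_sqrt_inner)
  then show ?thesis by (cases "z1 = z2") auto
qed

text \<open>\<open>prox\<close> is a Hilbert choice, so existence of a minimiser has to be supplied
  before anything can be said about it. Its optimality condition makes (w - prox) / \<gamma> a
  subgradient of R at the proximal point.\<close>

lemma prox_variational_inequality:
  fixes R :: "'a::euclidean_space \<Rightarrow> ereal"
  assumes R: "proper_closed_convex R" and g: "\<gamma> > 0"
  shows "\<exists>r. (prox \<gamma> R w, r) \<in> epi R \<and> (\<forall>y t. (y, t) \<in> epi R \<longrightarrow>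
    r \<le> t + inner ((1 / \<gamma>) *\<^sub>R (prox \<gamma> R w - w)) (y - prox \<gamma> R w))"
proof -
  let ?q = "\<lambda>x. 1 / (2 * \<gamma>) * (norm (x - w))\<^sup>2"
  \<comment> \<open>Dividing by the finite positive \<open>\<gamma>\<close> keeps the minimisers and
    leaves R without a factor.\<close>
  have scale: "ereal \<gamma> * R x + ereal (1 / 2 * (norm (x - w))\<^sup>2) = ereal \<gamma> * (R x + ereal (?q x))" for x
    using g by (cases "R x") (auto simp: algebra_simps)
  have less: "ereal \<gamma> * p < ereal \<gamma> * q \<longleftrightarrow> p < q" for p q
    using g by (cases p; cases q) auto
  have "is_arg_min (\<lambda>x. ereal \<gamma> * R x + ereal (1 / 2 * (norm (x - w))\<^sup>2)) (\<lambda>_. True)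
      = is_arg_min (\<lambda>x. R x + ereal (?q x)) (\<lambda>_. True)"
    by (simp only: is_arg_min_def fun_eq_iff scale less simp_thms)
  then have "is_arg_min (\<lambda>x. R x + ereal (?q x)) (\<lambda>_. True) (prox \<gamma> R w)"
    unfolding prox_def arg_min_def
    using someI_ex[OF proximal_objective_attains_min[OF R, of "1 / (2 * \<gamma>)" w]] g by simp
  moreover have "GDERIV ?q z :> (1 / \<gamma>) *\<^sub>R (z - w)" for z
    unfolding gderiv_def power2_norm_eq_inner
    by (rule derivative_eq_intros refl | simp add: algebra_simps inner_commute)+
  ultimately show ?thesis
    by (rule composite_minimizer_variational_inequality[OF R])
qed

lemma prox_nonexpansive:
  fixes R :: "'a::euclidean_space \<Rightarrow> ereal"
  assumes R: "proper_closed_convex R" and g: "\<gamma> > 0"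
  shows "norm (prox \<gamma> R v - prox \<gamma> R w) \<le> norm (v - w)"
  using prox_variational_inequality[OF R g, of v] prox_variational_inequality[OF R g, of w]
    variational_inequality_nonexpansive[OF g, of _ _ "epi R"] by metis

text \<open>The fixed point equation is used only implicitly: z satisfies the variational inequality
  of a proximal point of z - \<gamma> g, and this is compared with that of
  \<open>prox \<gamma> R w\<close>.\<close>

lemma norm_prox_minus_minimizer_le:
  fixes R :: "'a::euclidean_space \<Rightarrow> ereal"
  assumes R: "proper_closed_convex R" and \<gamma>: "\<gamma> > 0"
    and z: "is_arg_min (\<lambda>y. R y + ereal (\<phi> y)) (\<lambda>_. True) z" and grad: "GDERIV \<phi> z :> g"
  shows "norm (prox \<gamma> R w - z) \<le> norm (w - (z - \<gamma> *\<^sub>R g))"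
proof -
  obtain r where r: "(z, r) \<in> epi R" "\<And>y t. (y, t) \<in> epi R \<Longrightarrow> r \<le> t + inner g (y - z)"
    using composite_minimizer_variational_inequality[OF R z grad] by blast
  obtain r' where r': "(prox \<gamma> R w, r') \<in> epi R"
    "\<And>y t. (y, t) \<in> epi R \<Longrightarrow> r' \<le> t + inner ((1 / \<gamma>) *\<^sub>R (prox \<gamma> R w - w)) (y - prox \<gamma> R w)"
    using prox_variational_inequality[OF R \<gamma>, of w] by blast
  have "(1 / \<gamma>) *\<^sub>R (z - (z - \<gamma> *\<^sub>R g)) = g" using \<gamma> by simp
  then show ?thesis
    using r by (intro variational_inequality_nonexpansive[OF \<gamma> r'(1) r(1) r'(2)]) auto
qed

section \<open>Averages and the Lyapunov contraction\<close>

lemma avg_add: "avg M (\<lambda>m. f m + g m) = avg M f + avg M g"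
  by (simp add: avg_def sum.distrib scaleR_right_distrib)

lemma avg_diff: "avg M (\<lambda>m. f m - g m) = avg M f - avg M g"
  by (simp add: avg_def sum_subtractf scaleR_right_diff_distrib)

lemma avg_scaleR: "avg M (\<lambda>m. c *\<^sub>R f m) = c *\<^sub>R avg M f"
  by (simp add: avg_def scaleR_sum_right[symmetric])

lemma avg_mult: "avg M (\<lambda>m. c * f m) = c * avg M f" for c :: real
  using avg_scaleR[of M c f] by simp

lemma inner_avg: "inner e (avg M p) = avg M (\<lambda>m. inner e (p m))"
  by (simp add: avg_def inner_sum_right)

lemma avg_const: "M \<ge> 1 \<Longrightarrow> avg M (\<lambda>_. v) = v"
  by (simp add: avg_def sum_constant_scaleR del: sum_constant)

lemma avg_mono:
  fixes f g :: "nat \<Rightarrow> real"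
  assumes "\<And>m. m \<in> {1..M} \<Longrightarrow> f m \<le> g m"
  shows "avg M f \<le> avg M g"
  using assms by (auto simp: avg_def intro!: divide_right_mono sum_mono)

lemma avg_nonneg:
  fixes f :: "nat \<Rightarrow> real"
  assumes "\<And>m. m \<in> {1..M} \<Longrightarrow> 0 \<le> f m"
  shows "0 \<le> avg M f"
  using assms by (auto simp: avg_def intro!: divide_nonneg_nonneg sum_nonneg)

text \<open>Jensen's inequality, read off from the nonnegative mean squared deviation from the
  average.\<close>

lemma norm_avg_squared_le:
  fixes p :: "nat \<Rightarrow> 'a::real_inner"
  assumes "M \<ge> 1"
  shows "(norm (avg M p))\<^sup>2 \<le> avg M (\<lambda>m. (norm (p m))\<^sup>2)"
proof -
  have "(norm (p m - avg M p))\<^sup>2 = (norm (p m))\<^sup>2 - 2 * inner (avg M p) (p m) + (norm (avg M p))\<^sup>2" for m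
    by (simp add: power2_norm_eq_inner algebra_simps inner_commute)
  then have "avg M (\<lambda>m. (norm (p m - avg M p))\<^sup>2)
      = avg M (\<lambda>m. (norm (p m))\<^sup>2) - 2 * inner (avg M p) (avg M p) + (norm (avg M p))\<^sup>2"
    using assms by (simp add: avg_add avg_diff avg_mult avg_const inner_avg)
  moreover have "0 \<le> avg M (\<lambda>m. (norm (p m - avg M p))\<^sup>2)" by (rule avg_nonneg) simp
  ultimately show ?thesis by (simp add: power2_norm_eq_inner)
qed

text \<open>Young's inequality is used as the identity
  \<open>|p - q|\<^sup>2 = (1 + b) |p|\<^sup>2 + (1 + 1/b) |q|\<^sup>2 - |b p + q|\<^sup>2 / b\<close>: the defect terms
  of the first and of the second summand compensate each other by Jensen and \<open>\<zeta> \<le> \<omega>\<close>.\<close>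

lemma averaged_noise_bound:
  fixes p q :: "nat \<Rightarrow> 'a::real_inner"
  assumes M: "M \<ge> 1" and z: "0 \<le> \<zeta>" "\<zeta> \<le> \<omega>" and b: "b > 0"
  shows "\<omega> * avg M (\<lambda>m. (norm (p m - q m))\<^sup>2) - \<zeta> * (norm (avg M p - avg M q))\<^sup>2
    \<le> (1 + b) * \<omega> * avg M (\<lambda>m. (norm (p m))\<^sup>2) + (1 + 1 / b) * \<omega> * avg M (\<lambda>m. (norm (q m))\<^sup>2)
      - (1 + b) * \<zeta> * (norm (avg M p))\<^sup>2"
proof -
  have young: "(norm (u - v))\<^sup>2 = (1 + b) * (norm u)\<^sup>2 + (1 + 1 / b) * (norm v)\<^sup>2
      - (1 / b) * (norm (b *\<^sub>R u + v))\<^sup>2" for u v :: 'a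
    using b by (simp add: power2_norm_eq_inner inner_add_left inner_add_right inner_diff_left
        inner_diff_right inner_commute field_simps)
  define r where "r m = b *\<^sub>R p m + q m" for m
  have r: "avg M r = b *\<^sub>R avg M p + avg M q"
    unfolding r_def by (simp add: avg_add avg_scaleR)
  have "\<zeta> * (norm (avg M r))\<^sup>2 \<le> \<omega> * avg M (\<lambda>m. (norm (r m))\<^sup>2)"
    using z by (intro mult_mono norm_avg_squared_le M) auto
  then have "(1 / b) * (\<zeta> * (norm (avg M r))\<^sup>2) \<le> (1 / b) * (\<omega> * avg M (\<lambda>m. (norm (r m))\<^sup>2))"
    using b by (intro mult_left_mono) auto
  \<comment> \<open>The q part of the \<zeta> term has a favourable sign and is given up; its p part
    is kept, as it is what reduces the constant \<open>a\<close>.\<close>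
  moreover have "0 \<le> \<zeta> * ((1 + 1 / b) * (norm (avg M q))\<^sup>2)"
    using z b by simp
  moreover have avg_young: "avg M (\<lambda>m. (norm (p m - q m))\<^sup>2) = (1 + b) * avg M (\<lambda>m. (norm (p m))\<^sup>2)
      + (1 + 1 / b) * avg M (\<lambda>m. (norm (q m))\<^sup>2) - (1 / b) * avg M (\<lambda>m. (norm (r m))\<^sup>2)"
    unfolding young r_def by (simp only: avg_add avg_diff avg_mult)
  ultimately show ?thesis
    unfolding young[of "avg M p"] r[symmetric] avg_young by (simp add: algebra_simps)
qed

text \<open>The deterministic core of one round: e is the error of the iterate, p and q are the
  gradient and control errors, and the left side is the bound that remains once all randomness is
  averaged out.\<close>

lemma lyapunov_contraction:
  fixes p q :: "nat \<Rightarrow> 'a::real_inner" and e :: 'a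
  assumes M: "M \<ge> 1" and z: "0 \<le> \<zeta>" "\<zeta> \<le> \<omega>" and b: "b > 1"
    and pos: "\<gamma> > 0" "lam > 0" "\<rho> > 0" "L > 0"
    and coco: "\<And>m. m \<in> {1..M} \<Longrightarrow> (norm (p m))\<^sup>2 \<le> L * inner e (p m)"
    and mono: "\<mu> * (norm e)\<^sup>2 \<le> inner e (avg M p)"
    and eta: "0 \<le> \<eta>" "\<gamma> * L * (max (1 - (1 + b) * \<zeta>) 0 + (1 + b)\<^sup>2 * \<omega>) \<le> 2 * (1 - \<eta>)"
    and K: "K = (b\<^sup>2 + b) * \<gamma>\<^sup>2 * \<omega> * (\<rho> / lam)"
    and c: "1 - 2 * \<gamma> * \<eta> * \<mu> * \<rho> \<le> c" "1 - (1 - 1 / b\<^sup>2) * lam \<le> c"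
  shows "(1 - \<rho>) * (norm e)\<^sup>2 + \<rho> * ((norm (e - \<gamma> *\<^sub>R avg M p))\<^sup>2 +
      \<gamma>\<^sup>2 * (\<omega> * avg M (\<lambda>m. (norm (p m - q m))\<^sup>2) - \<zeta> * (norm (avg M p - avg M q))\<^sup>2)) +
      K * ((1 - lam) * avg M (\<lambda>m. (norm (q m))\<^sup>2) + lam * avg M (\<lambda>m. (norm (p m))\<^sup>2))
    \<le> c * ((norm e)\<^sup>2 + K * avg M (\<lambda>m. (norm (q m))\<^sup>2))"
proof -
  define A where "A = avg M (\<lambda>m. (norm (p m))\<^sup>2)"
  define B where "B = avg M (\<lambda>m. (norm (q m))\<^sup>2)"
  define I where "I = inner e (avg M p)"
  define a where "a = max (1 - (1 + b) * \<zeta>) 0"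
  define D where "D = a + (1 + b)\<^sup>2 * \<omega>"
  define P where "P = (norm (avg M p))\<^sup>2"
  define E where "E = (norm e)\<^sup>2"
  have nn: "0 \<le> A" "0 \<le> B" "0 \<le> D" "0 \<le> K"
    using z b pos by (auto simp: A_def B_def D_def a_def K intro!: avg_nonneg)
  have "A \<le> avg M (\<lambda>m. L * inner e (p m))" unfolding A_def by (intro avg_mono coco)
  then have AI: "A \<le> L * I" by (simp add: avg_mult inner_avg I_def)
  then have I: "0 \<le> I" using nn pos zero_le_mult_iff[of L I] by linarith
  have PA: "P \<le> A" unfolding P_def A_def by (rule norm_avg_squared_le[OF M])
  have sq: "(norm (e - \<gamma> *\<^sub>R avg M p))\<^sup>2 = E - 2 * \<gamma> * I + \<gamma>\<^sup>2 * P"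
    by (simp add: E_def I_def P_def power2_norm_eq_inner power2_eq_square[of \<gamma>] algebra_simps inner_commute)
  have noise: "\<omega> * avg M (\<lambda>m. (norm (p m - q m))\<^sup>2) - \<zeta> * (norm (avg M p - avg M q))\<^sup>2
      \<le> (1 + b) * \<omega> * A + (1 + 1 / b) * \<omega> * B - (1 + b) * \<zeta> * P"
    unfolding A_def B_def P_def using b by (intro averaged_noise_bound M z) auto
  \<comment> \<open>The maximum in \<open>a\<close> covers a negative coefficient, for which P <= A
    would point the wrong way.\<close>
  have "(1 - (1 + b) * \<zeta>) * P \<le> a * A"
    using PA nn by (intro mult_mono) (auto simp: a_def P_def)
  then have "P + ((1 + b) * \<omega> * A + (1 + 1 / b) * \<omega> * B - (1 + b) * \<zeta> * P)
      \<le> (a + (1 + b) * \<omega>) * A + (1 + 1 / b) * \<omega> * B"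
    by (simp add: algebra_simps)
  then have "\<gamma>\<^sup>2 * (P + (\<omega> * avg M (\<lambda>m. (norm (p m - q m))\<^sup>2) - \<zeta> * (norm (avg M p - avg M q))\<^sup>2))
      \<le> \<gamma>\<^sup>2 * ((a + (1 + b) * \<omega>) * A + (1 + 1 / b) * \<omega> * B)"
    using noise by (intro mult_left_mono) auto
  then have "\<rho> * ((norm (e - \<gamma> *\<^sub>R avg M p))\<^sup>2 + \<gamma>\<^sup>2 * (\<omega> * avg M (\<lambda>m. (norm (p m - q m))\<^sup>2) - \<zeta> * (norm (avg M p - avg M q))\<^sup>2))
      \<le> \<rho> * (E - 2 * \<gamma> * I + \<gamma>\<^sup>2 * ((a + (1 + b) * \<omega>) * A + (1 + 1 / b) * \<omega> * B))"
    unfolding sq using pos by (intro mult_left_mono) (auto simp: distrib_left)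
  then have "(1 - \<rho>) * E + \<rho> * ((norm (e - \<gamma> *\<^sub>R avg M p))\<^sup>2 + \<gamma>\<^sup>2 * (\<omega> * avg M (\<lambda>m. (norm (p m - q m))\<^sup>2) - \<zeta> * (norm (avg M p - avg M q))\<^sup>2))
        + K * ((1 - lam) * B + lam * A)
      \<le> E + \<rho> * (\<gamma>\<^sup>2 * D * A - 2 * \<gamma> * I) + (1 - (1 - 1 / b\<^sup>2) * lam) * (K * B)"
  proof -
    \<comment> \<open>Here (1 + b) + (b^2 + b) = (1 + b)^2 produces the constant \<open>D\<close> of
      the step size condition.\<close>
    have "\<rho> * \<gamma>\<^sup>2 * (a + (1 + b) * \<omega>) + K * lam = \<rho> * \<gamma>\<^sup>2 * D"
      using pos by (simp add: K D_def algebra_simps power2_eq_square)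
    then have "\<rho> * \<gamma>\<^sup>2 * (a + (1 + b) * \<omega>) * A + K * lam * A = \<rho> * \<gamma>\<^sup>2 * D * A"
      by (simp flip: distrib_right)
    \<comment> \<open>As 1 + 1/b = (b^2 + b) / b^2, the noise in q restores only a share 1/b^2 of
      the decrease \<open>K * lam * B\<close>.\<close>
    moreover have "\<rho> * \<gamma>\<^sup>2 * (1 + 1 / b) * \<omega> * B = K * lam / b\<^sup>2 * B"
      using pos b by (simp add: K field_simps power2_eq_square)
    ultimately show ?thesis
      using \<open>\<rho> * _ \<le> \<rho> * _\<close> by (simp add: algebra_simps)
  qed
  also have "\<dots> \<le> c * E + c * (K * B)"
  proof -
    \<comment> \<open>Of the descent 2 \<gamma> I, cocoercivity and the step size limit spend at
      most the fraction 1 - \<eta>. Strong monotonicity acts on the rest.\<close>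
    have "\<gamma> * D * A \<le> \<gamma> * D * (L * I)"
      using AI nn pos by (intro mult_left_mono) auto
    also have "\<dots> = (\<gamma> * L * D) * I" by simp
    also have "\<dots> \<le> 2 * (1 - \<eta>) * I"
      using eta(2) I by (intro mult_right_mono) (auto simp: D_def a_def)
    finally have "\<gamma> * (\<gamma> * D * A - 2 * I) \<le> \<gamma> * (2 * (1 - \<eta>) * I - 2 * I)"
      using pos by (intro mult_left_mono) auto
    also have "\<dots> = - (2 * \<gamma> * \<eta> * I)" by (simp add: algebra_simps)
    also have "\<dots> \<le> - (2 * \<gamma> * \<eta> * (\<mu> * E))"
      using mono pos eta by (simp add: I_def E_def mult_left_mono)
    finally have "\<rho> * (\<gamma>\<^sup>2 * D * A - 2 * \<gamma> * I) \<le> \<rho> * (- (2 * \<gamma> * \<eta> * (\<mu> * E)))"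
      using pos by (intro mult_left_mono) (auto simp: algebra_simps power2_eq_square)
    moreover have "(1 - 2 * \<gamma> * \<eta> * \<mu> * \<rho>) * E \<le> c * E"
      using c by (intro mult_right_mono) (auto simp: E_def)
    moreover have "(1 - (1 - 1 / b\<^sup>2) * lam) * (K * B) \<le> c * (K * B)"
      using c nn by (intro mult_right_mono) auto
    ultimately show ?thesis by (simp add: algebra_simps)
  qed
  finally show ?thesis by (simp add: A_def B_def E_def distrib_left)
qed

section \<open>Random maps and independence\<close>

text \<open>The cross term has mean zero.\<close>

lemma (in prob_space) bias_variance:
  fixes Z :: "'a \<Rightarrow> 'b::euclidean_space"
  assumes Z: "integrable M Z" and mean: "expectation Z = z"
    and var: "integrable M (\<lambda>s. (norm (Z s - z))\<^sup>2)"
  shows "integrable M (\<lambda>s. (norm (Z s - y))\<^sup>2)"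
    and "expectation (\<lambda>s. (norm (Z s - y))\<^sup>2)
      = (norm (z - y))\<^sup>2 + expectation (\<lambda>s. (norm (Z s - z))\<^sup>2)"
proof -
  have eq: "(norm (Z s - y))\<^sup>2 =
      (norm (z - y))\<^sup>2 + (2 * (inner (Z s) (z - y) - inner z (z - y)) + (norm (Z s - z))\<^sup>2)" for s
    by (simp add: power2_norm_eq_inner algebra_simps inner_commute)
  have i: "integrable M (\<lambda>s. 2 * (inner (Z s) (z - y) - inner z (z - y)))"
    using Z by simp
  show "integrable M (\<lambda>s. (norm (Z s - y))\<^sup>2)"
    unfolding eq using i var by (intro Bochner_Integration.integrable_add) auto
  have "expectation (\<lambda>s. 2 * (inner (Z s) (z - y) - inner z (z - y))) = 0"
    using Z mean by (simp add: prob_space)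
  then show "expectation (\<lambda>s. (norm (Z s - y))\<^sup>2)
      = (norm (z - y))\<^sup>2 + expectation (\<lambda>s. (norm (Z s - z))\<^sup>2)"
    unfolding eq using i var by (simp add: prob_space)
qed

text \<open>The bound on \<open>\<rho>\<close> gives \<rho> \<omega> <= 1 - \<rho>, so the variance
  is at most \<rho> (1 - \<rho>) |v|^2, exactly the defect of convexity in the last identity. It
  serves for the control update with \<open>lam\<close> and for the iterate with
  \<open>\<rho>\<close>.\<close>

lemma (in prob_space) relaxed_compressor:
  fixes Q :: "'a \<Rightarrow> 'b \<Rightarrow> 'b::euclidean_space"
  assumes Q: "unbiased_compressor M \<omega> Q" and \<omega>: "\<omega> \<ge> 0" and \<rho>: "0 < \<rho>" "\<rho> \<le> 1 / (1 + \<omega>)"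
  shows "integrable M (\<lambda>s. (norm (x + \<rho> *\<^sub>R Q s v - y))\<^sup>2)"
    and "expectation (\<lambda>s. (norm (x + \<rho> *\<^sub>R Q s v - y))\<^sup>2)
      \<le> (1 - \<rho>) * (norm (x - y))\<^sup>2 + \<rho> * (norm (x + v - y))\<^sup>2"
proof -
  let ?Z = "\<lambda>s. x + \<rho> *\<^sub>R Q s v"
  have int: "integrable M (\<lambda>s. Q s v)" and mean: "expectation (\<lambda>s. Q s v) = v"
    and var: "integrable M (\<lambda>s. (norm (Q s v - v))\<^sup>2)"
    and bound: "expectation (\<lambda>s. (norm (Q s v - v))\<^sup>2) \<le> \<omega> * (norm v)\<^sup>2"
    using Q by (auto simp: unbiased_compressor_def)
  have Z: "integrable M ?Z" "expectation ?Z = x + \<rho> *\<^sub>R v"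
    using int mean by (auto simp: prob_space)
  have dev: "(norm (?Z s - (x + \<rho> *\<^sub>R v)))\<^sup>2 = \<rho>\<^sup>2 * (norm (Q s v - v))\<^sup>2" for s
    by (simp add: power_mult_distrib flip: scaleR_diff_right)
  have Zvar: "integrable M (\<lambda>s. (norm (?Z s - (x + \<rho> *\<^sub>R v)))\<^sup>2)"
    unfolding dev using var by simp
  note bv = bias_variance[OF Z Zvar, of y]
  show "integrable M (\<lambda>s. (norm (?Z s - y))\<^sup>2)" by (rule bv)
  have "expectation (\<lambda>s. (norm (?Z s - y))\<^sup>2)
      = (norm (x + \<rho> *\<^sub>R v - y))\<^sup>2 + \<rho>\<^sup>2 * expectation (\<lambda>s. (norm (Q s v - v))\<^sup>2)"
    unfolding bv(2) dev by simp
  also have "\<dots> \<le> (norm (x + \<rho> *\<^sub>R v - y))\<^sup>2 + \<rho>\<^sup>2 * (\<omega> * (norm v)\<^sup>2)"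
    using bound by (intro add_left_mono mult_left_mono) auto
  also have "\<rho>\<^sup>2 * (\<omega> * (norm v)\<^sup>2) = \<rho> * (\<rho> * \<omega>) * (norm v)\<^sup>2" by (simp add: power2_eq_square)
  also have "\<rho> * (\<rho> * \<omega>) * (norm v)\<^sup>2 \<le> \<rho> * (1 - \<rho>) * (norm v)\<^sup>2"
    using \<rho> \<omega> by (intro mult_right_mono mult_left_mono) (auto simp: field_simps)
  \<comment> \<open>The point x + \<rho> v is the convex combination of x and x + v with weights 1 -
    \<rho> and \<rho>.\<close>
  also have "(norm (x + \<rho> *\<^sub>R v - y))\<^sup>2 + \<rho> * (1 - \<rho>) * (norm v)\<^sup>2
      = (1 - \<rho>) * (norm (x - y))\<^sup>2 + \<rho> * (norm (x + v - y))\<^sup>2"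
    by (simp add: power2_norm_eq_inner inner_add_left inner_add_right inner_diff_left
        inner_diff_right inner_commute power2_eq_square[of \<rho>] algebra_simps)
  finally show "expectation (\<lambda>s. (norm (?Z s - y))\<^sup>2)
      \<le> (1 - \<rho>) * (norm (x - y))\<^sup>2 + \<rho> * (norm (x + v - y))\<^sup>2" by simp
qed

text \<open>A substitute for conditional expectation. The identity map, read as a variable into
  \<open>A\<close> and into \<open>B\<close>, generates these sigma-algebras; by independence the
  diagonal pair (s, s) has the product law, and Tonelli applies.\<close>

lemma (in prob_space) nn_integral_independent_subalgebras:
  assumes A: "subalgebra M A" and B: "subalgebra M B"
    and indep: "indep_set (sets A) (sets B)"
    and f: "f \<in> borel_measurable (A \<Otimes>\<^sub>M B)"
  shows "(\<integral>\<^sup>+s. f (s, s) \<partial>M) = (\<integral>\<^sup>+s. \<integral>\<^sup>+t. f (s, t) \<partial>M \<partial>M)"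
proof -
  have m: "(\<lambda>x. x) \<in> measurable M S \<and> sigma_sets (space M) {(\<lambda>x. x) -` X \<inter> space M |X. X \<in> sets S} = sets S"
    if S: "subalgebra M S" for S
  proof -
    have "space S = space M" using S by (simp add: subalgebra_def)
    then have "X \<inter> space M = X" if "X \<in> sets S" for X
      using sets.sets_into_space[OF that] by auto
    then have "{X \<inter> space M |X. X \<in> sets S} = sets S"
      unfolding Setcompr_eq_image by (metis (no_types, lifting) image_cong image_ident)
    then show ?thesis
      using measurable_from_subalg[OF S measurable_ident_sets[OF refl]] \<open>space S = space M\<close>
        sets.sigma_sets_eq[of S] by simp
  qed
  have "indep_var A (\<lambda>x. x) B (\<lambda>x. x)"
    unfolding indep_var_eq using m[OF A] m[OF B] indep by simp
  then have distr: "distr M A (\<lambda>x. x) \<Otimes>\<^sub>M distr M B (\<lambda>x. x) = distr M (A \<Otimes>\<^sub>M B) (\<lambda>x. (x, x))"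
    by (simp add: indep_var_distribution_eq)
  have mA[measurable]: "(\<lambda>x. x) \<in> measurable M A" and mB[measurable]: "(\<lambda>x. x) \<in> measurable M B"
    using m[OF A] m[OF B] by auto
  interpret D: prob_space "distr M B (\<lambda>x. x)" by (rule prob_space_distr[OF mB])
  note f[measurable]
  have "(\<integral>\<^sup>+s. f (s, s) \<partial>M) = (\<integral>\<^sup>+z. f z \<partial>distr M (A \<Otimes>\<^sub>M B) (\<lambda>x. (x, x)))"
    by (subst nn_integral_distr) auto
  also have "\<dots> = (\<integral>\<^sup>+s. \<integral>\<^sup>+t. f (s, t) \<partial>distr M B (\<lambda>x. x) \<partial>distr M A (\<lambda>x. x))"
    unfolding distr[symmetric] by (rule D.nn_integral_fst[symmetric]) simp
  also have "\<dots> = (\<integral>\<^sup>+s. \<integral>\<^sup>+t. f (s, t) \<partial>distr M B (\<lambda>x. x) \<partial>M)"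
    by (rule nn_integral_distr[OF mA]) simp
  also have "\<dots> = (\<integral>\<^sup>+s. \<integral>\<^sup>+t. f (s, t) \<partial>M \<partial>M)"
  proof (rule nn_integral_cong)
    fix s assume "s \<in> space M"
    then have [simp]: "s \<in> space A" using measurable_space[OF mA] by simp
    show "(\<integral>\<^sup>+t. f (s, t) \<partial>distr M B (\<lambda>x. x)) = (\<integral>\<^sup>+t. f (s, t) \<partial>M)"
      by (rule nn_integral_distr[OF mB]) simp
  qed
  finally show ?thesis .
qed

lemma (in prob_space) indep_set_generated:
  assumes indep: "indep_sets (\<lambda>i. sets (E i)) UNIV" and disj: "I \<inter> J = {}"
  shows "indep_set (sigma_sets (space M) (\<Union>i\<in>I. sets (E i))) (sigma_sets (space M) (\<Union>i\<in>J. sets (E i)))"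
proof -
  have "indep_sets (\<lambda>j. sigma_sets (space M) (\<Union>i\<in>case_bool I J j. sets (E i))) UNIV"
  proof (rule indep_sets_collect_sigma)
    show "indep_sets (\<lambda>i. sets (E i)) (\<Union>j. case_bool I J j)"
      by (rule indep_sets_mono_index[OF _ indep]) simp
    show "disjoint_family (case_bool I J)"
      using disj by (auto simp: disjoint_family_on_def split: bool.split)
  qed (auto simp: Int_stable_def)
  then show ?thesis
    unfolding indep_set_def by (rule indep_sets_cong[THEN iffD1, rotated -1]) (auto split: bool.split)
qed

text \<open>The map \<open>\<pi>\<close> selects the outcome that drives the operator: the identity
  on the sample space, or the second projection on a product.\<close>

lemma measurable_random_map:
  assumes "random_map G Q" "\<pi> \<in> measurable N G" "v \<in> borel_measurable N"
  shows "(\<lambda>s. Q (\<pi> s) (v s)) \<in> borel_measurable N"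
  using measurable_compose[OF measurable_Pair[OF assms(2,3)] assms(1)[unfolded random_map_def]]
  by simp

lemma borel_measurable_avg:
  fixes f :: "nat \<Rightarrow> 's \<Rightarrow> 'b::euclidean_space"
  assumes "\<And>m. m \<in> {1..M} \<Longrightarrow> f m \<in> borel_measurable N"
  shows "(\<lambda>s. avg M (\<lambda>m. f m s)) \<in> borel_measurable N"
  unfolding avg_def using assms by (intro borel_measurable_scaleR borel_measurable_sum) auto

lemma has_bochner_integral_avg:
  fixes f :: "nat \<Rightarrow> 's \<Rightarrow> 'b::{banach, second_countable_topology}"
  assumes "\<And>m. m \<in> {1..M} \<Longrightarrow> integrable N (f m)"
  shows "has_bochner_integral N (\<lambda>s. avg M (\<lambda>m. f m s)) (avg M (\<lambda>m. integral\<^sup>L N (f m)))"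
  unfolding avg_def using assms
  by (intro has_bochner_integral_scaleR_right has_bochner_integral_sum has_bochner_integral_integrable)

text \<open>A bound on a Bochner integral is informative only for integrable functions. Here Jensen
  dominates the error of the average by the average of the errors.\<close>

lemma integrable_avg_compression_error:
  fixes C :: "nat \<Rightarrow> 's \<Rightarrow> 'b \<Rightarrow> 'b::euclidean_space"
  assumes M: "M \<ge> 1" and C: "\<And>m. m \<in> {1..M} \<Longrightarrow> unbiased_compressor P \<omega> (C m)"
  shows "integrable P (\<lambda>s. (norm (avg M (\<lambda>m. C m s (v m) - v m)))\<^sup>2)"
proof (rule Bochner_Integration.integrable_bound)
  show "integrable P (\<lambda>s. avg M (\<lambda>m. (norm (C m s (v m) - v m))\<^sup>2))"
    using C by (intro has_bochner_integral_avg[THEN has_bochner_integral_iff[THEN iffD1, THEN conjunct1]])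
      (auto simp: unbiased_compressor_def)
  have "(\<lambda>s. C m s (v m)) \<in> borel_measurable P" if "m \<in> {1..M}" for m
    using C[OF that] borel_measurable_integrable unfolding unbiased_compressor_def by blast
  then show "(\<lambda>s. (norm (avg M (\<lambda>m. C m s (v m) - v m)))\<^sup>2) \<in> borel_measurable P"
    by (intro borel_measurable_power measurable_compose[OF _ borel_measurable_norm] borel_measurable_avg borel_measurable_diff) auto
  show "AE s in P. norm ((norm (avg M (\<lambda>m. C m s (v m) - v m)))\<^sup>2)
      \<le> norm (avg M (\<lambda>m. (norm (C m s (v m) - v m))\<^sup>2))"
    using norm_avg_squared_le[OF M] by (auto intro!: AE_I2 order_trans[OF _ abs_ge_self])
qed

lemma borel_measurable_prox:
  assumes "proper_closed_convex R" "\<gamma> > 0"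
  shows "prox \<gamma> R \<in> borel_measurable borel"
proof -
  have "1-lipschitz_on UNIV (prox \<gamma> R)"
    using prox_nonexpansive[OF assms] by (intro lipschitz_onI) (auto simp: dist_norm)
  then show ?thesis
    by (intro borel_measurable_continuous_onI lipschitz_on_continuous_on)
qed

text \<open>The proximal map is removed pointwise, before taking expectations. The remaining point
  \<open>?Z\<close> is affine in the compressed vectors, so its mean is explicit and the
  bias-variance identity is exact.\<close>

lemma (in prob_space) expected_prox_step:
  fixes C :: "nat \<Rightarrow> 'a \<Rightarrow> 'b \<Rightarrow> 'b::euclidean_space" and x hb :: 'b and v :: "nat \<Rightarrow> 'b"
  assumes M: "n \<ge> 1" and C: "\<And>m. m \<in> {1..n} \<Longrightarrow> unbiased_compressor M \<omega> (C m)"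
    and R: "proper_closed_convex R" and \<gamma>: "\<gamma> > 0"
    and z: "is_arg_min (\<lambda>y. R y + ereal (\<phi> y)) (\<lambda>_. True) z" and grad: "GDERIV \<phi> z :> g"
  defines "X \<equiv> \<lambda>s. prox \<gamma> R (x - \<gamma> *\<^sub>R (hb + avg n (\<lambda>m. C m s (v m))))"
  shows "integrable M (\<lambda>s. (norm (X s - z))\<^sup>2)"
    and "expectation (\<lambda>s. (norm (X s - z))\<^sup>2)
      \<le> (norm (x - \<gamma> *\<^sub>R (hb + avg n v) - (z - \<gamma> *\<^sub>R g)))\<^sup>2
        + \<gamma>\<^sup>2 * expectation (\<lambda>s. (norm (avg n (\<lambda>m. C m s (v m) - v m)))\<^sup>2)"
proof -
  let ?Z = "\<lambda>s. x - \<gamma> *\<^sub>R (hb + avg n (\<lambda>m. C m s (v m)))"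
  have "has_bochner_integral M (\<lambda>s. avg n (\<lambda>m. C m s (v m))) (avg n (\<lambda>m. \<integral>s. C m s (v m) \<partial>M))"
    using C by (intro has_bochner_integral_avg) (auto simp: unbiased_compressor_def)
  moreover have "avg n (\<lambda>m. \<integral>s. C m s (v m) \<partial>M) = avg n v"
    using C by (simp add: avg_def unbiased_compressor_def)
  ultimately have "integrable M (\<lambda>s. avg n (\<lambda>m. C m s (v m)))"
    "expectation (\<lambda>s. avg n (\<lambda>m. C m s (v m))) = avg n v"
    by (auto simp: has_bochner_integral_iff)
  then have Z: "integrable M ?Z" "expectation ?Z = x - \<gamma> *\<^sub>R (hb + avg n v)"
    by (auto simp: prob_space)
  have "?Z s - (x - \<gamma> *\<^sub>R (hb + avg n v)) = - (\<gamma> *\<^sub>R avg n (\<lambda>m. C m s (v m) - v m))" for s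
    by (simp add: avg_diff algebra_simps)
  then have dev: "(norm (?Z s - (x - \<gamma> *\<^sub>R (hb + avg n v))))\<^sup>2
      = \<gamma>\<^sup>2 * (norm (avg n (\<lambda>m. C m s (v m) - v m)))\<^sup>2" for s
    by (simp add: power_mult_distrib)
  have var: "integrable M (\<lambda>s. (norm (?Z s - (x - \<gamma> *\<^sub>R (hb + avg n v))))\<^sup>2)"
    unfolding dev using integrable_avg_compression_error[OF M C] by simp
  note bv = bias_variance[OF Z var, of "z - \<gamma> *\<^sub>R g"]
  have le: "(norm (X s - z))\<^sup>2 \<le> (norm (?Z s - (z - \<gamma> *\<^sub>R g)))\<^sup>2" for s
    unfolding X_def by (intro power_mono norm_prox_minus_minimizer_le[OF R \<gamma> z grad]) simp
  have "X \<in> borel_measurable M"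
    unfolding X_def using measurable_compose[OF borel_measurable_integrable[OF Z(1)] borel_measurable_prox[OF R \<gamma>]] .
  then show int: "integrable M (\<lambda>s. (norm (X s - z))\<^sup>2)"
    using le by (intro Bochner_Integration.integrable_bound[OF bv(1)]) auto
  have "expectation (\<lambda>s. (norm (X s - z))\<^sup>2) \<le> expectation (\<lambda>s. (norm (?Z s - (z - \<gamma> *\<^sub>R g)))\<^sup>2)"
    using int bv(1) le by (intro integral_mono)
  then show "expectation (\<lambda>s. (norm (X s - z))\<^sup>2)
      \<le> (norm (x - \<gamma> *\<^sub>R (hb + avg n v) - (z - \<gamma> *\<^sub>R g)))\<^sup>2
        + \<gamma>\<^sup>2 * expectation (\<lambda>s. (norm (avg n (\<lambda>m. C m s (v m) - v m)))\<^sup>2)"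
    unfolding bv(2) dev by simp
qed

lemma GDERIV_avg:
  assumes "\<And>m. m \<in> {1..M} \<Longrightarrow> GDERIV (F m) y :> g m"
  shows "GDERIV (\<lambda>y. avg M (\<lambda>m. F m y)) y :> avg M g"
proof -
  have "((\<lambda>y. avg M (\<lambda>m. F m y)) has_derivative (\<lambda>u. (1 / real M) *\<^sub>R (\<Sum>m=1..M. inner u (g m)))) (at y)"
    unfolding avg_def using assms
    by (intro has_derivative_scaleR_right has_derivative_sum) (auto simp: gderiv_def)
  then show ?thesis by (simp add: gderiv_def avg_def inner_sum_right)
qed

section \<open>Convergence of MURANA\<close>

theorem theorem3:
  fixes M :: nat
    and F :: "nat \<Rightarrow> 'a::euclidean_space \<Rightarrow> real"
    and grad :: "nat \<Rightarrow> 'a \<Rightarrow> 'a"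
    and R :: "'a \<Rightarrow> ereal"
    and P :: "'s measure"
    and G H :: "nat \<Rightarrow> 's measure"
    and C U :: "nat \<Rightarrow> nat \<Rightarrow> 's \<Rightarrow> 'a \<Rightarrow> 'a"
    and Q :: "nat \<Rightarrow> 's \<Rightarrow> 'a \<Rightarrow> 'a"
    and L \<mu> \<omega>C \<omega>U \<omega>R \<omega>av \<zeta> \<gamma> lam \<rho> \<omega>U' \<omega>R' a b \<eta> c :: real
    and xstar x0 :: 'a
    and h0 :: "nat \<Rightarrow> 'a"
    and x hbar :: "nat \<Rightarrow> 's \<Rightarrow> 'a"
    and h :: "nat \<Rightarrow> 's \<Rightarrow> nat \<Rightarrow> 'a"
    and \<Psi> :: "'a \<Rightarrow> (nat \<Rightarrow> 'a) \<Rightarrow> real"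
  assumes M: "M \<ge> 1"
    and L: "L > 0"
    and mu: "\<mu> > 0"
    and F_convex: "\<And>m. m \<in> {1..M} \<Longrightarrow> convex_on UNIV (F m)"
    and F_gradient: "\<And>m y. m \<in> {1..M} \<Longrightarrow> GDERIV (F m) y :> grad m y"
    and F_smooth: "\<And>m. m \<in> {1..M} \<Longrightarrow> L-lipschitz_on UNIV (grad m)"
    and F_strongly_convex:
      "convex_on UNIV (\<lambda>y. avg M (\<lambda>m. F m y) - \<mu> / 2 * (norm y)\<^sup>2)"
    and R: "proper_closed_convex R"
    and xstar: "is_arg_min (\<lambda>y. R y + ereal (avg M (\<lambda>m. F m y))) (\<lambda>_. True) xstar"
    and P: "prob_space P"
    and omegas: "\<omega>C \<ge> 0" "\<omega>U \<ge> 0" "\<omega>R \<ge> 0" "\<omega>av \<ge> 0" "\<zeta> \<in> {0..\<omega>av}"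
    and C: "\<And>k m. m \<in> {1..M} \<Longrightarrow> unbiased_compressor P \<omega>C (C k m)"
    and U: "\<And>k m. m \<in> {1..M} \<Longrightarrow> unbiased_compressor P \<omega>U (U k m)"
    and Q: "\<And>k. unbiased_compressor P \<omega>R (Q k)"
    and C_avg: "\<And>k v.
      (\<integral>s. (norm (avg M (\<lambda>m. C k m s (v m) - v m)))\<^sup>2 \<partial>P)
        \<le> \<omega>av / real M * (\<Sum>m=1..M. (norm (v m))\<^sup>2) - \<zeta> * (norm (avg M v))\<^sup>2"
    and indep: "independent_rounds P M G H C U Q"
    and iterates: "\<And>k s. (x k s, h k s, hbar k s) =
      murana M grad R \<gamma> lam \<rho> x0 h0 (\<lambda>k m. C k m s) (\<lambda>k m. U k m s) (\<lambda>k. Q k s) k"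
    and lam: "0 < lam" "lam \<le> 1 / (1 + \<omega>U)"
    and rho: "0 < \<rho>" "\<rho> \<le> 1 / (1 + \<omega>R)"
    and omegaU': "\<omega>U' = 1 / lam - 1"
    and omegaR': "\<omega>R' = 1 / \<rho> - 1"
    and b: "b > 1"
    and a: "a = max (1 - (1 + b) * \<zeta>) 0"
    and gamma: "0 < \<gamma>" "\<gamma> < 2 / L * (1 / (a + (1 + b)\<^sup>2 * \<omega>av))"
    and eta: "\<eta> = 1 - \<gamma> * inverse (2 / L * (1 / (a + (1 + b)\<^sup>2 * \<omega>av)))"
    and Psi: "\<And>y g. \<Psi> y g = (norm (y - xstar))\<^sup>2 +
      (b\<^sup>2 + b) * \<gamma>\<^sup>2 * \<omega>av * ((1 + \<omega>U') / (1 + \<omega>R')) *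
        (1 / real M * (\<Sum>m=1..M. (norm (g m - grad m xstar))\<^sup>2))"
    and c: "c = 1 - min (2 * \<gamma> * \<eta> * \<mu> / (1 + \<omega>R')) ((1 - 1 / b\<^sup>2) / (1 + \<omega>U'))"
  shows "\<omega>U' \<ge> \<omega>U \<and> \<omega>R' \<ge> \<omega>R \<and> 0 < \<eta> \<and> \<eta> < 1 \<and> c < 1 \<and>
    (\<forall>k. integrable P (\<lambda>s. \<Psi> (x k s) (h k s)) \<and>
         (\<integral>s. \<Psi> (x k s) (h k s) \<partial>P) \<le> c ^ k * \<Psi> x0 h0)"
proof -
  interpret prob_space P by (rule P)

  \<comment> \<open>Constants and their ranges\<close>
  define K where "K = (b\<^sup>2 + b) * \<gamma>\<^sup>2 * \<omega>av * (\<rho> / lam)"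
  define D where "D = a + (1 + b)\<^sup>2 * \<omega>av"
  have ratio: "(1 + \<omega>U') / (1 + \<omega>R') = \<rho> / lam" using lam rho by (simp add: omegaU' omegaR')
  have Psi': "\<Psi> y g = (norm (y - xstar))\<^sup>2 + K * avg M (\<lambda>m. (norm (g m - grad m xstar))\<^sup>2)" for y g
    unfolding Psi ratio K_def by (simp add: avg_def)
  have K0: "K \<ge> 0" using b omegas lam rho by (auto simp: K_def)
  \<comment> \<open>Since 1 / 0 = 0, the case D = 0 would also leave no admissible step
    size.\<close>
  have D0: "D > 0"
  proof (rule ccontr)
    assume "\<not> D > 0"
    then have "2 / L * (1 / D) \<le> 0" using L by (simp add: divide_le_0_iff mult_le_0_iff)
    then show False using gamma unfolding D_def by linarith
  qed
  have eta': "\<eta> = 1 - \<gamma> * L * D / 2" by (simp add: eta D_def)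
  have gLD: "0 < \<gamma> * L * D" "\<gamma> * L * D < 2"
    using gamma L D0 unfolding D_def[symmetric] by (auto simp: field_simps)
  have eta01: "0 < \<eta>" "\<eta> < 1" using gLD by (auto simp: eta')
  have omU: "\<omega>U' \<ge> \<omega>U" and omR: "\<omega>R' \<ge> \<omega>R"
    using lam rho omegas by (auto simp: omegaU' omegaR' field_simps)
  have lam1: "lam \<le> 1" "\<rho> \<le> 1"
    using lam rho omegas by (auto intro: order_trans simp: divide_le_eq_1)
  have b2: "0 < 1 / b\<^sup>2" "1 / b\<^sup>2 < 1" using b by (auto simp: power2_eq_square less_1_mult)
  have c': "c = 1 - min (2 * \<gamma> * \<eta> * \<mu> * \<rho>) ((1 - 1 / b\<^sup>2) * lam)"
    by (simp add: c omegaU' omegaR')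
  have c1: "c < 1" using gamma eta01 mu rho lam b2 by (simp add: c')
  \<comment> \<open>The sign allows c to pass through \<open>ennreal\<close> products in the
    induction.\<close>
  have c0: "0 \<le> c"
  proof -
    have "(1 - 1 / b\<^sup>2) * lam \<le> 1 * 1" using b2 lam lam1 by (intro mult_mono) auto
    then show ?thesis by (simp add: c')
  qed
  have grad_avg: "GDERIV (\<lambda>y. avg M (\<lambda>m. F m y)) y :> avg M (\<lambda>m. grad m y)" for y
    by (rule GDERIV_avg) (rule F_gradient)

  \<comment> \<open>One round from a frozen state, averaged over \<open>C\<close> and
    \<open>U\<close>\<close>
  have round: "integrable P (\<lambda>t. (1 - \<rho>) * (norm (y - xstar))\<^sup>2
        + \<rho> * (norm (prox \<gamma> R (y - \<gamma> *\<^sub>R (avg M g + avg M (\<lambda>m. C k m t (grad m y - g m)))) - xstar))\<^sup>2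
        + K * avg M (\<lambda>m. (norm (g m + lam *\<^sub>R U k m t (grad m y - g m) - grad m xstar))\<^sup>2))"
    and round_le: "(\<integral>t. (1 - \<rho>) * (norm (y - xstar))\<^sup>2
        + \<rho> * (norm (prox \<gamma> R (y - \<gamma> *\<^sub>R (avg M g + avg M (\<lambda>m. C k m t (grad m y - g m)))) - xstar))\<^sup>2
        + K * avg M (\<lambda>m. (norm (g m + lam *\<^sub>R U k m t (grad m y - g m) - grad m xstar))\<^sup>2) \<partial>P)
      \<le> c * \<Psi> y g" for k y g
  proof -
    let ?A = "(1 - \<rho>) * (norm (y - xstar))\<^sup>2"
    let ?N = "\<lambda>t. (norm (prox \<gamma> R (y - \<gamma> *\<^sub>R (avg M g + avg M (\<lambda>m. C k m t (grad m y - g m)))) - xstar))\<^sup>2"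
    let ?V = "\<lambda>m t. (norm (g m + lam *\<^sub>R U k m t (grad m y - g m) - grad m xstar))\<^sup>2"
    define p where "p m = grad m y - grad m xstar" for m
    define q where "q m = g m - grad m xstar" for m
    define e where "e = y - xstar"
    have v: "grad m y - g m = p m - q m" for m by (simp add: p_def q_def)
    note prox_step = expected_prox_step[where v = "\<lambda>m. grad m y - g m" and hb = "avg M g" and x = y,
        OF M C[where k = k] R gamma(1) xstar grad_avg]
    have "y - \<gamma> *\<^sub>R (avg M g + avg M (\<lambda>m. grad m y - g m)) - (xstar - \<gamma> *\<^sub>R avg M (\<lambda>m. grad m xstar))
        = e - \<gamma> *\<^sub>R avg M p"
      unfolding p_def e_def avg_diff by (simp add: algebra_simps)
    with prox_step(2)
    have "expectation ?N \<le> (norm (e - \<gamma> *\<^sub>R avg M p))\<^sup>2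
        + \<gamma>\<^sup>2 * (\<integral>t. (norm (avg M (\<lambda>m. C k m t (grad m y - g m) - (grad m y - g m))))\<^sup>2 \<partial>P)"
      by simp
    also have "\<dots> \<le> (norm (e - \<gamma> *\<^sub>R avg M p))\<^sup>2
        + \<gamma>\<^sup>2 * (\<omega>av * avg M (\<lambda>m. (norm (p m - q m))\<^sup>2) - \<zeta> * (norm (avg M p - avg M q))\<^sup>2)"
      using C_avg[of k "\<lambda>m. grad m y - g m"] unfolding v avg_diff[of M p q]
      by (intro add_left_mono mult_left_mono) (auto simp: avg_def)
    finally have N: "expectation ?N \<le> \<dots>" .
    have Uint: "integrable P (?V m)" and Ule: "expectation (?V m) \<le> (1 - lam) * (norm (q m))\<^sup>2 + lam * (norm (p m))\<^sup>2"
      if "m \<in> {1..M}" for m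
      using relaxed_compressor[OF U[OF that, of k] omegas(2) lam, of "g m" "grad m y - g m" "grad m xstar"]
      by (auto simp: p_def q_def)
    have hV: "has_bochner_integral P (\<lambda>t. avg M (\<lambda>m. ?V m t)) (avg M (\<lambda>m. expectation (?V m)))"
      by (rule has_bochner_integral_avg) (rule Uint)
    have V: "avg M (\<lambda>m. expectation (?V m))
        \<le> (1 - lam) * avg M (\<lambda>m. (norm (q m))\<^sup>2) + lam * avg M (\<lambda>m. (norm (p m))\<^sup>2)"
      unfolding avg_mult[symmetric] avg_add[symmetric] by (intro avg_mono Ule)
    have Nint: "integrable P ?N" using prox_step(1) by simp
    have Vint: "integrable P (\<lambda>t. avg M (\<lambda>m. ?V m t))"
      and Veq: "expectation (\<lambda>t. avg M (\<lambda>m. ?V m t)) = avg M (\<lambda>m. expectation (?V m))"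
      using hV by (auto simp: has_bochner_integral_iff)
    show "integrable P (\<lambda>t. ?A + \<rho> * ?N t + K * avg M (\<lambda>m. ?V m t))"
      using Nint Vint by simp
    \<comment> \<open>\<open>?N\<close> and \<open>?V\<close> use operators of the same round, which
      may be dependent; only linearity of expectation joins them.\<close>
    have "(\<integral>t. ?A + \<rho> * ?N t + K * avg M (\<lambda>m. ?V m t) \<partial>P)
        = ?A + \<rho> * expectation ?N + K * avg M (\<lambda>m. expectation (?V m))"
      using Nint Vint Veq by (simp add: prob_space)
    also have "\<dots> \<le> (1 - \<rho>) * (norm e)\<^sup>2 + \<rho> * ((norm (e - \<gamma> *\<^sub>R avg M p))\<^sup>2
        + \<gamma>\<^sup>2 * (\<omega>av * avg M (\<lambda>m. (norm (p m - q m))\<^sup>2) - \<zeta> * (norm (avg M p - avg M q))\<^sup>2))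
        + K * ((1 - lam) * avg M (\<lambda>m. (norm (q m))\<^sup>2) + lam * avg M (\<lambda>m. (norm (p m))\<^sup>2))"
      using N V rho lam1 K0 unfolding e_def by (intro add_mono mult_left_mono) auto
    also have "\<dots> \<le> c * ((norm e)\<^sup>2 + K * avg M (\<lambda>m. (norm (q m))\<^sup>2))"
    proof (rule lyapunov_contraction[OF M _ _ b gamma(1) lam(1) rho(1) L])
      show "(norm (p m))\<^sup>2 \<le> L * inner e (p m)" if "m \<in> {1..M}" for m
        using gradient_cocoercive[OF F_convex F_gradient F_smooth L, OF that that that]
        by (simp add: p_def e_def inner_commute)
      show "\<mu> * (norm e)\<^sup>2 \<le> inner e (avg M p)"
        using strongly_convex_gradient_monotone[OF F_strongly_convex grad_avg, of y xstar]
        unfolding p_def e_def avg_diff by (simp add: inner_commute)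
      show "\<gamma> * L * (max (1 - (1 + b) * \<zeta>) 0 + (1 + b)\<^sup>2 * \<omega>av) \<le> 2 * (1 - \<eta>)"
        using a by (simp add: eta' D_def)
    qed (use omegas eta01 in \<open>auto simp: K_def c'\<close>)
    finally show "(\<integral>t. ?A + \<rho> * ?N t + K * avg M (\<lambda>m. ?V m t) \<partial>P) \<le> c * \<Psi> y g"
      by (simp add: Psi' e_def q_def)
  qed

  \<comment> \<open>The recursion for the iterates\<close>
  define xt where "xt k s t = prox \<gamma> R (x k s - \<gamma> *\<^sub>R (hbar k s + avg M (\<lambda>m. C k m t (grad m (x k s) - h k s m))))"
    for k s t
  have init: "x 0 s = x0" "h 0 s = h0" "hbar 0 s = avg M h0" for s
    using iterates[of 0 s] by simp_all
  \<comment> \<open>The algorithm uses \<open>xt k s t\<close> only for s = t; off the diagonal, s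
    drives the state and t the fresh operators \<open>C k\<close>.\<close>
  have step: "x (Suc k) s = x k s + \<rho> *\<^sub>R Q k s (xt k s s - x k s)"
      "h (Suc k) s = (\<lambda>m. h k s m + lam *\<^sub>R U k m s (grad m (x k s) - h k s m))"
      "hbar (Suc k) s = hbar k s + lam *\<^sub>R avg M (\<lambda>m. U k m s (grad m (x k s) - h k s m))" for k s
    using iterates[of "Suc k" s] unfolding murana.simps iterates[of k s, symmetric]
    by (simp_all add: murana_step_def xt_def)
  have hbar: "hbar k s = avg M (h k s)" for k s
    by (induction k) (simp_all add: init step avg_add avg_scaleR)

  \<comment> \<open>Sigma-algebras generated by groups of operators\<close>
  define E where "E = case_sum G H"
  define Fil where "Fil I = sigma (space P) (\<Union>i\<in>I. sets (E i))" for I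
  have subE: "subalgebra P (E i)" for i
    using indep by (auto simp: E_def independent_rounds_def split: sum.split)
  have pow: "(\<Union>i\<in>I. sets (E i)) \<subseteq> Pow (space P)" for I
    using subE sets.sets_into_space by (fastforce simp: subalgebra_def)
  have space_Fil: "space (Fil I) = space P" for I
    unfolding Fil_def by (rule space_measure_of[OF pow])
  have sets_Fil: "sets (Fil I) = sigma_sets (space P) (\<Union>i\<in>I. sets (E i))" for I
    unfolding Fil_def by (rule sets_measure_of[OF pow])
  have subFil: "subalgebra P (Fil I)" for I
    using subE by (auto simp: subalgebra_def space_Fil sets_Fil intro!: sets.sigma_sets_subset)
  have Fil_mono: "f \<in> borel_measurable (Fil J)" if "f \<in> borel_measurable (Fil I)" "I \<subseteq> J" for f :: "'s \<Rightarrow> 'a" and I J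
  proof (rule measurable_from_subalg[OF _ that(1)])
    show "subalgebra (Fil J) (Fil I)"
      using that(2) by (auto simp: subalgebra_def space_Fil sets_Fil intro!: sigma_sets_mono')
  qed
  have Fil_E: "(\<lambda>s. s) \<in> measurable (Fil I) (E i)" if "i \<in> I" for i I
  proof -
    have "subalgebra (Fil I) (E i)"
      using subE[of i] that by (auto simp: subalgebra_def space_Fil sets_Fil)
    then show ?thesis by (rule measurable_from_subalg) (rule measurable_ident_sets[OF refl])
  qed
  have ind: "indep_set (sets (Fil I)) (sets (E i))" if "i \<notin> I" for I i
  proof -
    have "indep_sets (\<lambda>i. sets (E i)) UNIV"
      using indep by (auto simp: independent_rounds_def E_def sum.case_distrib[of sets] cong: sum.case_cong)
    then have "indep_set (sigma_sets (space P) (\<Union>i\<in>I. sets (E i))) (sigma_sets (space P) (\<Union>i\<in>{i}. sets (E i)))"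
      using that by (intro indep_set_generated) auto
    then show ?thesis
      using sets.sigma_sets_eq[of "E i"] subE[of i] by (simp add: sets_Fil subalgebra_def)
  qed
  \<comment> \<open>Strictly earlier rounds only: the state with index k has not yet met the
    operators of round k.\<close>
  define past where "past k = Inl ` {..<k} \<union> Inr ` {..<k}" for k :: nat
  have past_Suc: "past (Suc k) = insert (Inr k) (insert (Inl k) (past k))" for k
    by (auto simp: past_def lessThan_Suc)
  \<comment> \<open>The two integrations of a round: \<open>C k\<close> and \<open>U k\<close>
    against the past, and \<open>Q k\<close> against the past enlarged by \<open>C k\<close> and
    \<open>U k\<close>.\<close>
  have fresh: "Inl k \<notin> past k" "Inr k \<notin> insert (Inl k) (past k)" for k
    by (auto simp: past_def)
  have mC: "random_map (E (Inl k)) (C k m)" and mU: "random_map (E (Inl k)) (U k m)" if "m \<in> {1..M}" for k m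
    using indep that by (auto simp: independent_rounds_def E_def)
  have mQ: "random_map (E (Inr k)) (Q k)" for k
    using indep by (auto simp: independent_rounds_def E_def)
  have mgrad: "grad m \<in> borel_measurable borel" if "m \<in> {1..M}" for m
    using F_smooth[OF that] by (intro borel_measurable_continuous_onI lipschitz_on_continuous_on)
  note mprox = borel_measurable_prox[OF R gamma(1)]

  \<comment> \<open>Measurability of the iterates relative to the past\<close>
  define adapted where "adapted k \<longleftrightarrow> x k \<in> borel_measurable (Fil (past k)) \<and>
      hbar k \<in> borel_measurable (Fil (past k)) \<and>
      (\<forall>m\<in>{1..M}. (\<lambda>s. h k s m) \<in> borel_measurable (Fil (past k)))" for k
  \<comment> \<open>With \<open>\<sigma>\<close> and \<open>\<pi>\<close> general, the same facts
    give adaptedness (both the identity) and measurability on the product space (the two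
    projections).\<close>
  have xt_meas: "(\<lambda>z. xt k (\<sigma> z) (\<pi> z)) \<in> borel_measurable N"
    and U_meas: "\<And>m. m \<in> {1..M} \<Longrightarrow>
      (\<lambda>z. U k m (\<pi> z) (grad m (x k (\<sigma> z)) - h k (\<sigma> z) m)) \<in> borel_measurable N"
    if "adapted k" and \<sigma>: "\<sigma> \<in> measurable N (Fil (past k))" and \<pi>: "\<pi> \<in> measurable N (E (Inl k))"
    for k N and \<sigma> \<pi> :: "'n \<Rightarrow> 's"
  proof -
    have x: "(\<lambda>z. x k (\<sigma> z)) \<in> borel_measurable N" and hb: "(\<lambda>z. hbar k (\<sigma> z)) \<in> borel_measurable N"
      and h: "\<And>m. m \<in> {1..M} \<Longrightarrow> (\<lambda>z. h k (\<sigma> z) m) \<in> borel_measurable N"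
      using \<open>adapted k\<close> measurable_compose[OF \<sigma>, of "x k"]
        measurable_compose[OF \<sigma>, of "hbar k"]
        measurable_compose[OF \<sigma>, of "\<lambda>s. h k s m" _ for m]
      by (auto simp: adapted_def)
    have d: "(\<lambda>z. grad m (x k (\<sigma> z)) - h k (\<sigma> z) m) \<in> borel_measurable N" if "m \<in> {1..M}" for m
      by (intro borel_measurable_diff measurable_compose[OF x mgrad] h that)
    show "(\<lambda>z. U k m (\<pi> z) (grad m (x k (\<sigma> z)) - h k (\<sigma> z) m)) \<in> borel_measurable N"
      if "m \<in> {1..M}" for m
      by (rule measurable_random_map[OF mU[OF that] \<pi> d[OF that]])
    have "(\<lambda>z. avg M (\<lambda>m. C k m (\<pi> z) (grad m (x k (\<sigma> z)) - h k (\<sigma> z) m))) \<in> borel_measurable N"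
      by (intro borel_measurable_avg measurable_random_map[OF mC _ d] \<pi>)
    then show "(\<lambda>z. xt k (\<sigma> z) (\<pi> z)) \<in> borel_measurable N"
      unfolding xt_def using x hb
      by (intro measurable_compose[OF _ mprox] borel_measurable_diff borel_measurable_scaleR
          borel_measurable_add) auto
  qed
  have id_past: "(\<lambda>s. s) \<in> measurable (Fil J) (Fil (past k))" if "past k \<subseteq> J" for J k
  proof (rule measurable_from_subalg)
    show "subalgebra (Fil J) (Fil (past k))"
      using that by (auto simp: subalgebra_def space_Fil sets_Fil intro!: sigma_sets_mono')
  qed (rule measurable_ident_sets[OF refl])
  have adapted: "adapted k" for k
  proof (induction k)
    case 0
    have "x 0 = (\<lambda>_. x0)" "hbar 0 = (\<lambda>_. avg M h0)" by (simp_all add: fun_eq_iff init)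
    then show ?case by (simp add: adapted_def init)
  next
    case (Suc k)
    let ?N = "Fil (past (Suc k))"
    have past_le: "past k \<subseteq> past (Suc k)" and Inl: "Inl k \<in> past (Suc k)" and Inr: "Inr k \<in> past (Suc k)"
      by (auto simp: past_Suc)
    note pre = Suc id_past[OF past_le] Fil_E[OF Inl]
    have x: "x k \<in> borel_measurable ?N" and hb: "hbar k \<in> borel_measurable ?N"
      and h: "\<And>m. m \<in> {1..M} \<Longrightarrow> (\<lambda>s. h k s m) \<in> borel_measurable ?N"
      using Suc unfolding adapted_def by (blast intro: Fil_mono[OF _ past_le])+
    have "(\<lambda>s. xt k s s - x k s) \<in> borel_measurable ?N"
      by (rule borel_measurable_diff[OF xt_meas[OF pre] x])
    from measurable_random_map[OF mQ Fil_E[OF Inr] this]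
    have "(\<lambda>s. x (Suc k) s) \<in> borel_measurable ?N"
      unfolding step by (rule borel_measurable_add[OF x borel_measurable_scaleR[OF borel_measurable_const]])
    moreover have "(\<lambda>s. hbar (Suc k) s) \<in> borel_measurable ?N"
      unfolding step
      by (intro borel_measurable_add borel_measurable_scaleR borel_measurable_const borel_measurable_avg
          hb U_meas[OF pre])
    moreover have "(\<lambda>s. h (Suc k) s m) \<in> borel_measurable ?N" if "m \<in> {1..M}" for m
      unfolding step
      by (intro borel_measurable_add borel_measurable_scaleR borel_measurable_const
          h[OF that] U_meas[OF pre that])
    ultimately show ?case by (simp add: adapted_def)
  qed
  have xP: "x k \<in> borel_measurable P" and hP: "\<And>m. m \<in> {1..M} \<Longrightarrow> (\<lambda>s. h k s m) \<in> borel_measurable P" for k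
    using adapted[of k] unfolding adapted_def by (blast intro: measurable_from_subalg[OF subFil])+
  have errP: "(\<lambda>s. avg M (\<lambda>m. (norm (h k s m - grad m xstar))\<^sup>2)) \<in> borel_measurable P" for k
    by (intro borel_measurable_avg borel_measurable_power measurable_compose[OF _ borel_measurable_norm] borel_measurable_diff
        borel_measurable_const hP)
  have Psi_meas: "(\<lambda>s. \<Psi> (x k s) (h k s)) \<in> borel_measurable P" for k
    unfolding Psi'
    by (intro borel_measurable_add borel_measurable_times borel_measurable_power measurable_compose[OF _ borel_measurable_norm]
        borel_measurable_diff borel_measurable_const xP errP)
  have avg0: "0 \<le> avg M (\<lambda>m. (norm (g m))\<^sup>2)" for g :: "nat \<Rightarrow> 'a"
    by (rule avg_nonneg) simp
  have Psi0: "0 \<le> \<Psi> y g" for y g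
    unfolding Psi' using K0 avg0 by simp

  \<comment> \<open>Induction over the rounds with nonnegative integrals\<close>
  have bound: "(\<integral>\<^sup>+s. ennreal (\<Psi> (x k s) (h k s)) \<partial>P) \<le> ennreal (c ^ k * \<Psi> x0 h0)" for k
  proof (induction k)
    case 0
    then show ?case by (simp add: init emeasure_space_1)
  next
    case (Suc k)
    define V where "V s t = K * avg M (\<lambda>m. (norm (h k s m + lam *\<^sub>R U k m t (grad m (x k s) - h k s m)
        - grad m xstar))\<^sup>2)" for s t
    \<comment> \<open>What remains of the squared distance of the new iterate once
      \<open>Q k\<close> is averaged out.\<close>
    define S where "S s t = (1 - \<rho>) * (norm (x k s - xstar))\<^sup>2 + \<rho> * (norm (xt k s t - xstar))\<^sup>2" for s t
    let ?J = "insert (Inl k) (past k)"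
    let ?X = "\<lambda>s t. x k s + \<rho> *\<^sub>R Q k t (xt k s s - x k s) - xstar"
    have S0: "0 \<le> S s t" and V0: "0 \<le> V s t" for s t
      using rho lam1 K0 avg0 by (auto simp: S_def V_def)
    have xJ: "x k \<in> borel_measurable (Fil ?J)"
      using adapted[of k] unfolding adapted_def by (intro Fil_mono[of _ "past k" ?J]) auto
    have xtJ: "(\<lambda>s. xt k s s) \<in> borel_measurable (Fil ?J)"
      by (rule xt_meas[OF adapted id_past Fil_E]) auto
    have S_meas: "(\<lambda>s. S s s) \<in> borel_measurable (Fil ?J)"
      unfolding S_def
      by (intro borel_measurable_add borel_measurable_times borel_measurable_power measurable_compose[OF _ borel_measurable_norm]
          borel_measurable_diff borel_measurable_const xJ xtJ)
    have Veq: "V s s = K * avg M (\<lambda>m. (norm (h (Suc k) s m - grad m xstar))\<^sup>2)" for s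
      by (simp add: V_def step)
    have V_meas: "(\<lambda>s. V s s) \<in> borel_measurable P"
      unfolding Veq by (intro borel_measurable_times borel_measurable_const errP)
    have X_meas: "(\<lambda>(s, t). ennreal ((norm (?X s t))\<^sup>2)) \<in> borel_measurable (Fil ?J \<Otimes>\<^sub>M E (Inr k))"
      unfolding split_beta
      by (intro measurable_compose[OF _ measurable_ennreal] borel_measurable_power measurable_compose[OF _ borel_measurable_norm]
          borel_measurable_diff borel_measurable_add borel_measurable_scaleR borel_measurable_const
          measurable_random_map[OF mQ measurable_snd] measurable_compose[OF measurable_fst xJ]
          measurable_compose[OF measurable_fst xtJ])
    \<comment> \<open>Only the distance term needs this integration: the new control vectors,
      collected in \<open>V\<close>, do not involve \<open>Q k\<close>.\<close>
    have x_step: "(\<integral>\<^sup>+s. ennreal ((norm (x (Suc k) s - xstar))\<^sup>2) \<partial>P) \<le> (\<integral>\<^sup>+s. ennreal (S s s) \<partial>P)"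
    proof -
      have "(\<integral>\<^sup>+s. ennreal ((norm (x (Suc k) s - xstar))\<^sup>2) \<partial>P) = (\<integral>\<^sup>+s. \<integral>\<^sup>+t. ennreal ((norm (?X s t))\<^sup>2) \<partial>P \<partial>P)"
        using nn_integral_independent_subalgebras[OF subFil subE ind[OF fresh(2)] X_meas] by (simp add: step)
      also have "\<dots> \<le> (\<integral>\<^sup>+s. ennreal (S s s) \<partial>P)"
      proof (rule nn_integral_mono)
        fix s
        show "(\<integral>\<^sup>+t. ennreal ((norm (?X s t))\<^sup>2) \<partial>P) \<le> ennreal (S s s)"
          using relaxed_compressor[OF Q[of k] omegas(3) rho, of "x k s" "xt k s s - x k s" xstar]
          by (subst nn_integral_eq_integral) (auto simp: S_def ennreal_leI)
      qed
      finally show ?thesis .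
    qed
    have W_meas: "(\<lambda>(s, t). ennreal (S s t + V s t)) \<in> borel_measurable (Fil (past k) \<Otimes>\<^sub>M E (Inl k))"
    proof -
      let ?N = "Fil (past k) \<Otimes>\<^sub>M E (Inl k)"
      have x: "(\<lambda>z. x k (fst z)) \<in> borel_measurable ?N"
        and h: "\<And>m. m \<in> {1..M} \<Longrightarrow> (\<lambda>z. h k (fst z) m) \<in> borel_measurable ?N"
        using adapted[of k] unfolding adapted_def
        by (blast intro: measurable_compose[OF measurable_fst]
            measurable_compose[OF measurable_fst, where g = "\<lambda>s. h k s m" for m])+
      note pre = adapted[of k] measurable_fst[of "Fil (past k)" "E (Inl k)"] measurable_snd[of "Fil (past k)" "E (Inl k)"]
      show ?thesis
        unfolding split_beta S_def V_def
        by (intro measurable_compose[OF _ measurable_ennreal] borel_measurable_add borel_measurable_times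
            borel_measurable_power measurable_compose[OF _ borel_measurable_norm] borel_measurable_diff borel_measurable_scaleR
            borel_measurable_const borel_measurable_avg x h xt_meas[OF pre] U_meas[OF pre])
    qed
    have "(\<integral>\<^sup>+s. ennreal (\<Psi> (x (Suc k) s) (h (Suc k) s)) \<partial>P)
        = (\<integral>\<^sup>+s. ennreal ((norm (x (Suc k) s - xstar))\<^sup>2) + ennreal (V s s) \<partial>P)"
      unfolding Psi' Veq[symmetric] using V0 by (simp flip: ennreal_plus)
    also have "\<dots> = (\<integral>\<^sup>+s. ennreal ((norm (x (Suc k) s - xstar))\<^sup>2) \<partial>P) + (\<integral>\<^sup>+s. ennreal (V s s) \<partial>P)"
      using xP[of "Suc k"] V_meas by (intro nn_integral_add) auto
    also have "\<dots> \<le> (\<integral>\<^sup>+s. ennreal (S s s) \<partial>P) + (\<integral>\<^sup>+s. ennreal (V s s) \<partial>P)"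
      by (intro add_right_mono x_step)
    also have "\<dots> = (\<integral>\<^sup>+s. ennreal (S s s + V s s) \<partial>P)"
      using measurable_from_subalg[OF subFil S_meas] V_meas S0 V0
      by (subst nn_integral_add[symmetric]) auto
    \<comment> \<open>\<open>S\<close> and \<open>V\<close> are separated from the past jointly,
      because both depend on the operators of round k at the same outcome.\<close>
    also have "\<dots> = (\<integral>\<^sup>+s. \<integral>\<^sup>+t. ennreal (S s t + V s t) \<partial>P \<partial>P)"
      using nn_integral_independent_subalgebras[OF subFil subE ind[OF fresh(1)] W_meas] by simp
    also have "\<dots> \<le> (\<integral>\<^sup>+s. ennreal c * ennreal (\<Psi> (x k s) (h k s)) \<partial>P)"
    proof (rule nn_integral_mono)
      fix s
      have "integrable P (\<lambda>t. S s t + V s t)" "(\<integral>t. S s t + V s t \<partial>P) \<le> c * \<Psi> (x k s) (h k s)"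
        using round[of "x k s" "h k s" k] round_le[of "x k s" "h k s" k]
        by (simp_all add: S_def V_def xt_def hbar)
      then show "(\<integral>\<^sup>+t. ennreal (S s t + V s t) \<partial>P) \<le> ennreal c * ennreal (\<Psi> (x k s) (h k s))"
        using S0 V0 c0 Psi0 by (subst nn_integral_eq_integral) (auto simp: ennreal_leI simp flip: ennreal_mult)
    qed
    also have "\<dots> = ennreal c * (\<integral>\<^sup>+s. ennreal (\<Psi> (x k s) (h k s)) \<partial>P)"
      using Psi_meas by (intro nn_integral_cmult) auto
    also have "\<dots> \<le> ennreal c * ennreal (c ^ k * \<Psi> x0 h0)"
      by (intro mult_left_mono Suc) simp
    also have "\<dots> = ennreal (c ^ Suc k * \<Psi> x0 h0)"
      using c0 Psi0 by (simp add: mult.assoc flip: ennreal_mult)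
    finally show ?case .
  qed

  \<comment> \<open>Return to the Bochner integral\<close>
  have "integrable P (\<lambda>s. \<Psi> (x k s) (h k s)) \<and>
      (\<integral>s. \<Psi> (x k s) (h k s) \<partial>P) \<le> c ^ k * \<Psi> x0 h0" for k
  proof -
    \<comment> \<open>The bound just proved is finite, and for a nonnegative measurable function
      this yields integrability.\<close>
    have int: "integrable P (\<lambda>s. \<Psi> (x k s) (h k s))"
      using bound[of k] Psi0 Psi_meas
      by (intro integrableI_nonneg) (auto intro: le_less_trans)
    then have "ennreal (\<integral>s. \<Psi> (x k s) (h k s) \<partial>P) \<le> ennreal (c ^ k * \<Psi> x0 h0)"
      using bound[of k] Psi0 by (simp add: nn_integral_eq_integral)
    then show ?thesis using int c0 Psi0 by simp
  qed
  then show ?thesis using omU omR eta01 c1 by blast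
qed

end
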